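(* Let $n = p_1^{\alpha_1}\cdots p_r^{\alpha_r}$ be the prime factorisation of a positive integer $n$ (distinct primes, $\alpha_i>0$). Then \[\det(A_n) = \prod_{\substack{d_1, d_2 \mid n\\ 1 \le d_1 < d_2 \le n}} \mathcal{R}(\Phi_{d_2}, \Phi_{d_1}) = (-1)^{n-1}\prod_{i=1}^r p_i^{\frac{n(1-p_i^{-\alpha_i})}{p_i-1}}.\]
   Context: $\Phi_d$ is the $d$th cyclotomic polynomial. $\Psi_n : \mathbf{Z}[X]/(X^n-1) \to \bigoplus_{d \mid n} \mathbf{Z}[X]/(\Phi_d(X))$ is the natural map $f\bmod(X^n-1)\mapsto\bigoplus_{d\mid n}f\bmod\Phi_d(X)$, and $A_n$ is its matrix with respect to the basis $(1,\overline{X},\dots,\overline{X}^{n-1})$ of the domain and the bases $(1,\overline{X},\dots,\overline{X}^{\phi(d)-1})$ of the summands, with summands ordered by increasing $d$ (the $j$th column of $A_n$ is the coordinate vector of $\Psi_n(\overline{X}^j)$). For monic polynomials $f,g$, the resultant is $\mathcal{R}(f,g) = \prod_{\alpha}\prod_{\beta}(\alpha-\beta)$, the product over the roots $\alpha$ of $f$ and $\beta$ of $g$ (with multiplicity) in an algebraic closure. *)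

theory Defs
  imports "HOL-Analysis.Analysis" "HOL-Computational_Algebra.Computational_Algebra"
    "HOL-Number_Theory.Totient" "Subresultants.Resultant_Prelim"
begin

definition cyclotomic_complex :: "nat \<Rightarrow> complex poly" where
  "cyclotomic_complex d =
     (\<Prod>k\<in>{k. k < d \<and> coprime k d}. [:- cis (2 * pi * real k / real d), 1:])"

definition cyclotomic :: "nat \<Rightarrow> int poly" where
  "cyclotomic d = (THE p. map_poly of_int p = cyclotomic_complex d)"

definition divisors_sorted :: "nat \<Rightarrow> nat list" where
  "divisors_sorted n = sorted_list_of_set {d. d dvd n}"

text \<open>Row labels of A_n: the pairs (d,i) with d | n (increasing) and i < phi(d),
  i.e. the coordinate X^i of the summand Z[X]/(Phi_d).\<close>
definition row_labels :: "nat \<Rightarrow> (nat \<times> nat) list" where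
  "row_labels n = concat (map (\<lambda>d. map (\<lambda>i. (d, i)) [0..<totient d]) (divisors_sorted n))"

text \<open>Remainder of f modulo a monic integer polynomial g, i.e. the canonical
  representative of f in Z[X]/(g) with respect to the basis 1, X, ..., X^(deg g - 1).\<close>
definition int_poly_rem :: "int poly \<Rightarrow> int poly \<Rightarrow> int poly" where
  "int_poly_rem f g = (THE r. (r = 0 \<or> degree r < degree g) \<and> g dvd (f - r))"

text \<open>The matrix A_n: column j is the coordinate vector of Psi_n(X^j), i.e. the
  coefficients of X^j mod Phi_d for d | n.\<close>
definition A_mat :: "nat \<Rightarrow> int mat" where
  "A_mat n = mat n n (\<lambda>(r, j). (case row_labels n ! r of (d, i) \<Rightarrow>
       coeff (int_poly_rem (Polynomial.monom 1 j) (cyclotomic d)) i))"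

end

theory Submission
  imports Defs "HOL-Number_Theory.Cong" "HOL-Number_Theory.Prime_Powers"
begin

text \<open>
  Evaluating a remainder modulo \<open>\<Phi>\<^sub>d\<close> at the primitive \<open>d\<close>-th roots of unity turns \<open>A\<^sub>n\<close> into the
  Vandermonde matrix of all \<open>n\<close>-th roots of unity, grouped by order: \<open>B * A\<^sub>n = V\<close> with \<open>B\<close> block
  diagonal, the blocks being the Vandermonde matrices of the individual \<open>\<Phi>\<^sub>d\<close>. Dividing determinants
  leaves the differences of roots of different orders. Multiplying the Sylvester matrix by a
  Vandermonde matrix in the same way shows that these differences make up the resultants.

  Writing \<open>w\<^sub>k\<close> for the \<open>k\<close>-th of the \<open>n\<close>-th roots of unity, the square of the absolute value of the
  product is the product of \<open>|w\<^sub>k - w\<^sub>l|\<close> over all pairs with \<open>gcd k n \<noteq> gcd l n\<close>, that is, the product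
  over \<open>c\<close> of \<open>|1 - w\<^sub>c|\<close> to the power \<open>N c\<close>, the number of \<open>k\<close> with \<open>gcd k n \<noteq> gcd (k + c) n\<close>.
  Here \<open>N c\<close> depends only on the order \<open>e\<close> of \<open>w\<^sub>c\<close>, and the \<open>|1 - z|\<close> with \<open>z\<close> of order \<open>e\<close> multiply
  to \<open>exp (\<Lambda> e)\<close>, so that only prime powers \<open>e\<close> contribute; for these \<open>N c\<close> is counted directly.
  The sign comes from \<open>\<R>(\<Phi>\<^sub>2, \<Phi>\<^sub>1) = -2\<close> alone: for \<open>d > 2\<close> the roots of \<open>\<Phi>\<^sub>d\<close> form conjugate pairs,
  whence \<open>\<R>(\<Phi>\<^sub>d, \<Phi>\<^sub>e) > 0\<close>.
\<close>

section \<open>Vandermonde matrices and resultants\<close>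

text \<open>The number of columns is independent of the number of nodes: applied to the coefficients
  of a polynomial of degree below \<open>N\<close>, the matrix returns its values at all nodes, and
  matrices for several lists can be stacked.\<close>

definition vandermonde_mat :: "nat \<Rightarrow> 'a list \<Rightarrow> 'a :: comm_ring_1 mat" where
  "vandermonde_mat N xs = mat (length xs) N (\<lambda>(i, j). xs ! i ^ j)"

primrec vandermonde_prod :: "'a list \<Rightarrow> 'a :: comm_ring_1" where
  "vandermonde_prod [] = 1"
| "vandermonde_prod (x # xs) = (\<Prod>y\<leftarrow>xs. y - x) * vandermonde_prod xs"

definition poly_of_roots :: "'a list \<Rightarrow> 'a :: comm_ring_1 poly" where
  "poly_of_roots xs = (\<Prod>x\<leftarrow>xs. [:- x, 1:])"

lemma prod_list_swap:
  fixes g :: "'b \<Rightarrow> 'c \<Rightarrow> 'a :: comm_monoid_mult"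
  shows "(\<Prod>y\<leftarrow>ys. \<Prod>x\<leftarrow>xs. g x y) = (\<Prod>x\<leftarrow>xs. \<Prod>y\<leftarrow>ys. g x y)"
proof (induction xs)
  case (Cons x xs)
  have "(\<Prod>y\<leftarrow>ys. a y * b y) = (\<Prod>y\<leftarrow>ys. a y) * (\<Prod>y\<leftarrow>ys. b y)" for a b :: "'c \<Rightarrow> 'a"
    by (induction ys) (simp_all add: mult_ac)
  with Cons show ?case by simp
qed (induction ys, auto)

lemma vandermonde_mat_carrier [simp]: "vandermonde_mat N xs \<in> carrier_mat (length xs) N"
  by (simp add: vandermonde_mat_def)

lemma vandermonde_prod_append:
  "vandermonde_prod (xs @ ys) =
     vandermonde_prod xs * vandermonde_prod ys * (\<Prod>x\<leftarrow>xs. \<Prod>y\<leftarrow>ys. y - x)"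
  by (induction xs) (simp_all add: algebra_simps)

lemma vandermonde_prod_nonzero:
  fixes xs :: "'a :: idom list"
  shows "distinct xs \<Longrightarrow> vandermonde_prod xs \<noteq> 0"
  by (induction xs) (auto simp: prod_list_zero_iff)

text \<open>Scaling the rows is left multiplication by the diagonal matrix
  \<open>?D\<close>.\<close>

lemma det_scale_rows:
  fixes B :: "'a :: idom mat"
  assumes B: "B \<in> carrier_mat n n" and len: "length cs = n"
  shows "det (mat n n (\<lambda>(i, j). cs ! i * B $$ (i, j))) = prod_list cs * det B"
proof -
  let ?D = "mat n n (\<lambda>(i, j). if i = j then cs ! i else 0)"
  have "mat n n (\<lambda>(i, j). cs ! i * B $$ (i, j)) = ?D * B"
  proof (rule eq_matI)
    fix i j assume "i < dim_row (?D * B)" "j < dim_col (?D * B)"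
    then have ij: "i < n" "j < n" using B by auto
    have "(?D * B) $$ (i, j) = (\<Sum>k = 0..<n. (if i = k then cs ! i else 0) * B $$ (k, j))"
      using ij B by (auto simp: scalar_prod_def intro!: sum.cong)
    also have "\<dots> = (\<Sum>k = 0..<n. if i = k then cs ! i * B $$ (k, j) else 0)"
      by (rule sum.cong) auto
    also have "\<dots> = cs ! i * B $$ (i, j)" using ij by simp
    finally show "mat n n (\<lambda>(i, j). cs ! i * B $$ (i, j)) $$ (i, j) = (?D * B) $$ (i, j)"
      using ij by simp
  qed (use B in auto)
  moreover have "det (?D * B) = det ?D * det B"
    by (rule det_mult[OF _ B]) simp
  moreover have "det ?D = prod_list (diag_mat ?D)"
    by (rule det_upper_triangular[of _ n]) (auto simp: upper_triangular_def)
  moreover have "diag_mat ?D = cs"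
    by (rule nth_equalityI) (auto simp: diag_mat_def len)
  ultimately show ?thesis by simp
qed

text \<open>Right multiplication by the unitriangular matrix \<open>?U\<close> subtracts
  \<open>x\<close> times the preceding column from each column but the first. The row of
  \<open>x\<close> becomes (1, 0, ..., 0), and the row of any other node \<open>y\<close> becomes 1
  followed by \<open>y - x\<close> times its row in the smaller Vandermonde matrix.\<close>

lemma det_vandermonde_mat:
  fixes xs :: "'a :: idom list"
  shows "det (vandermonde_mat (length xs) xs) = vandermonde_prod xs"
proof (induction xs)
  case Nil
  show ?case by (simp add: vandermonde_mat_def)
next
  case (Cons x xs)
  let ?n = "length xs"
  let ?V = "vandermonde_mat (Suc ?n) (x # xs)"
  let ?U = "mat (Suc ?n) (Suc ?n) (\<lambda>(i, j). if i = j then 1 else if Suc i = j then - x else (0::'a))"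
  let ?W = "mat ?n ?n (\<lambda>(i, j). (map (\<lambda>y. y - x) xs) ! i * vandermonde_mat ?n xs $$ (i, j))"
  let ?F = "four_block_mat (1\<^sub>m 1) (0\<^sub>m 1 ?n) (mat ?n 1 (\<lambda>_. 1)) ?W"
  have "?V * ?U = ?F"
  proof (rule eq_matI)
    fix i j assume "i < dim_row ?F" "j < dim_col ?F"
    then have ij: "i < Suc ?n" "j < Suc ?n" by auto
    let ?y = "(x # xs) ! i"
    have "(?V * ?U) $$ (i, j) =
        (\<Sum>k = 0..<Suc ?n. ?y ^ k * (if k = j then 1 else if Suc k = j then - x else 0))"
      using ij by (auto simp: vandermonde_mat_def scalar_prod_def simp del: sum.op_ivl_Suc intro!: sum.cong)
    also have "\<dots> = (\<Sum>k = 0..<Suc ?n. (if k = j then ?y ^ k else 0) +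
        (if Suc k = j then - x * ?y ^ k else 0))"
      by (rule sum.cong) auto
    also have "\<dots> = ?y ^ j + (\<Sum>k = 0..<Suc ?n. if Suc k = j then - x * ?y ^ k else 0)"
      using ij by (simp add: sum.distrib del: sum.op_ivl_Suc)
    also have "(\<Sum>k = 0..<Suc ?n. if Suc k = j then - x * ?y ^ k else 0) =
        (if j = 0 then 0 else - x * ?y ^ (j - 1))"
    proof (cases j)
      case (Suc l)
      then have "(\<Sum>k = 0..<Suc ?n. if Suc k = j then - x * ?y ^ k else 0) =
          (\<Sum>k = 0..<Suc ?n. if k = l then - x * ?y ^ k else 0)"
        by (intro sum.cong) auto
      also have "\<dots> = - x * ?y ^ l" using ij Suc by (simp del: sum.op_ivl_Suc)
      finally show ?thesis using Suc by simp
    qed simp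
    finally have *: "(?V * ?U) $$ (i, j) = ?y ^ j + (if j = 0 then 0 else - x * ?y ^ (j - 1))" .
    show "(?V * ?U) $$ (i, j) = ?F $$ (i, j)"
      unfolding * using ij
      by (cases i; cases j) (auto simp: vandermonde_mat_def algebra_simps)
  qed (auto simp: vandermonde_mat_def)
  then have "det ?F = det (?V * ?U)" by simp
  also have "\<dots> = det ?V * det ?U"
    by (rule det_mult[of _ "Suc ?n"]) (auto simp: vandermonde_mat_def)
  also have "det ?U = prod_list (diag_mat ?U)"
    by (rule det_upper_triangular[of _ "Suc ?n"]) (auto simp: upper_triangular_def)
  also have "diag_mat ?U = replicate (Suc ?n) 1"
    by (rule nth_equalityI) (auto simp: diag_mat_def simp del: upt_Suc replicate.simps)
  finally have "det ?V = det ?F" by simp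
  also have "\<dots> = det (1\<^sub>m 1 :: 'a mat) * det ?W"
    by (rule det_four_block_mat_upper_right_zero) auto
  also have "\<dots> = vandermonde_prod (x # xs)"
    by (subst det_scale_rows) (auto simp: Cons)
  finally show ?case by simp
qed

text \<open>Rows and columns each contribute the sign of \<open>p\<close>, and the square of a sign
  is 1.\<close>

lemma det_permute_rows_cols:
  fixes A :: "'a :: comm_ring_1 mat"
  assumes A: "A \<in> carrier_mat n n" and p: "p permutes {0..<n}"
  shows "det (mat n n (\<lambda>(i, j). A $$ (p i, p j))) = det A"
proof -
  let ?B = "mat n n (\<lambda>(i, j). A $$ (p i, j))"
  have B: "?B \<in> carrier_mat n n" by simp
  have p': "p i < n" if "i < n" for i
    using permutes_in_image[OF p, of i] that by simp
  have "mat n n (\<lambda>(i, j). A $$ (p i, p j)) =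
      transpose_mat (mat n n (\<lambda>(i, j). transpose_mat ?B $$ (p i, j)))"
    by (rule eq_matI) (auto simp: p')
  then have "det (mat n n (\<lambda>(i, j). A $$ (p i, p j))) = signof p * (signof p * det A)"
    using A B p by (simp add: det_transpose[of _ n] det_permute_rows)
  then show ?thesis by (simp add: sign_def)
qed

section \<open>Polynomials given by their roots, and their resultants\<close>

lemma poly_of_roots_simps [simp]:
  "poly_of_roots [] = 1"
  "poly_of_roots (x # xs) = [:- x, 1:] * poly_of_roots xs"
  by (simp_all add: poly_of_roots_def)

lemma poly_poly_of_roots: "poly (poly_of_roots xs) y = (\<Prod>x\<leftarrow>xs. y - x)"
  by (induction xs) (simp_all add: algebra_simps)

lemma degree_monic_poly_of_roots:
  fixes xs :: "'a :: idom list"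
  shows "degree (poly_of_roots xs) = length xs \<and> lead_coeff (poly_of_roots xs) = 1"
proof (induction xs)
  case (Cons x xs)
  then have "poly_of_roots xs \<noteq> 0" by auto
  then have "degree (poly_of_roots (x # xs)) = Suc (length xs)"
    unfolding poly_of_roots_simps by (subst degree_mult_eq) (auto simp: Cons)
  moreover have "lead_coeff (poly_of_roots (x # xs)) = 1"
    unfolding poly_of_roots_simps lead_coeff_mult using conjunct2[OF Cons] by simp
  ultimately show ?case by simp
qed simp

lemma poly_eq_sum_atLeastLessThan:
  fixes p :: "'a :: comm_ring_1 poly"
  assumes "p = 0 \<or> degree p < N"
  shows "(\<Sum>k = 0..<N. coeff p k * x ^ k) = poly p x"
proof -
  have "(\<Sum>k = 0..<N. coeff p k * x ^ k) = (\<Sum>k\<le>degree p. coeff p k * x ^ k)"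
    using assms by (intro sum.mono_neutral_cong) (auto simp: coeff_eq_0)
  then show ?thesis by (simp add: poly_altdef)
qed


text \<open>The Vandermonde matrix of all roots, times the rearranged Sylvester matrix, contains the
  values of the shifts of \<open>p\<close> and \<open>q\<close> at these roots. It is block diagonal
  because \<open>p\<close> vanishes on \<open>xs\<close> and \<open>q\<close> on \<open>ys\<close>.
  Distinct roots make the Vandermonde determinant nonzero, so that it can be cancelled.\<close>

lemma resultant_poly_of_roots:
  fixes xs ys :: "'a :: idom list"
  assumes dist: "distinct (xs @ ys)"
  shows "resultant (poly_of_roots xs) (poly_of_roots ys) = (\<Prod>x\<leftarrow>xs. \<Prod>y\<leftarrow>ys. x - y)"
proof -
  let ?m = "length xs" and ?n = "length ys"
  define N where "N = ?m + ?n"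
  define p where "p = poly_of_roots xs"
  define q where "q = poly_of_roots ys"
  have deg: "degree p = ?m" "degree q = ?n"
    using degree_monic_poly_of_roots[of xs] degree_monic_poly_of_roots[of ys]
    by (simp_all add: p_def q_def)
  have nz: "p \<noteq> 0" "q \<noteq> 0"
    using degree_monic_poly_of_roots[of xs] degree_monic_poly_of_roots[of ys]
    by (auto simp: p_def q_def)
  define S where "S = sylvester_mat p q"
  have S: "S \<in> carrier_mat N N"
    using sylvester_carrier_mat[of p q] by (simp add: S_def N_def deg)
  \<comment> \<open>The Sylvester matrix lists coefficients from the highest power down, and the
    shifts of \<open>p\<close> before those of \<open>q\<close>. Reversing rows and columns alike
    reverses both orders and keeps the determinant; column \<open>j\<close> of \<open>S'\<close> is
    then the coefficient vector of \<open>row j\<close>.\<close>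
  define r where "r = (\<lambda>i. if i < N then N - 1 - i else i)"
  have r: "r permutes {0..<N}"
    by (rule bij_imp_permutes, rule bij_betwI[of _ _ _ r]) (auto simp: r_def)
  define row where "row = (\<lambda>i. if i < ?m then Polynomial.monom 1 i * q else Polynomial.monom 1 (i - ?m) * p)"
  define S' where "S' = mat N N (\<lambda>(i, j). transpose_mat S $$ (r i, r j))"
  have S': "S' \<in> carrier_mat N N" by (simp add: S'_def)
  have det_S': "det S' = det S"
    unfolding S'_def by (subst det_permute_rows_cols[OF _ r]) (use S in \<open>auto simp: det_transpose\<close>)
  have S'_index: "S' $$ (i, j) = coeff (row j) i" if "i < N" "j < N" for i j
  proof -
    have "S' $$ (i, j) = S $$ (N - 1 - j, N - 1 - i)"
      using that S by (simp add: S'_def r_def)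
    also have "\<dots> = coeff (row j) i"
      unfolding S_def using that
      by (subst sylvester_index_mat2) (auto simp: deg N_def row_def coeff_monom_mult)
    finally show ?thesis .
  qed
  have row: "row j = 0 \<or> degree (row j) < N" if "j < N" for j
    using that nz by (auto simp: row_def degree_mult_eq degree_monom_eq deg N_def)
  let ?V = "vandermonde_mat N (xs @ ys)"
  let ?A = "mat ?m ?m (\<lambda>(i, j). map (poly q) xs ! i * vandermonde_mat ?m xs $$ (i, j))"
  let ?B = "mat ?n ?n (\<lambda>(i, j). map (poly p) ys ! i * vandermonde_mat ?n ys $$ (i, j))"
  let ?F = "four_block_mat ?A (0\<^sub>m ?m ?n) (0\<^sub>m ?n ?m) ?B"
  have V: "?V \<in> carrier_mat N N" using vandermonde_mat_carrier[of N "xs @ ys"] by (simp add: N_def)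
  have px: "poly p (xs ! i) = 0" if "i < ?m" for i
    using that by (auto simp: p_def poly_poly_of_roots prod_list_zero_iff)
  have qy: "poly q (ys ! i) = 0" if "i < ?n" for i
    using that by (auto simp: q_def poly_poly_of_roots prod_list_zero_iff)
  have "?V * S' = ?F"
  proof (rule eq_matI)
    fix i j assume "i < dim_row ?F" "j < dim_col ?F"
    then have ij: "i < N" "j < N" by (auto simp: N_def)
    have "(?V * S') $$ (i, j) = (\<Sum>k = 0..<N. (xs @ ys) ! i ^ k * coeff (row j) k)"
      using ij S' V by (auto simp: scalar_prod_def S'_index vandermonde_mat_def N_def intro!: sum.cong)
    also have "\<dots> = poly (row j) ((xs @ ys) ! i)"
      by (subst poly_eq_sum_atLeastLessThan[OF row[OF ij(2)], symmetric]) (simp add: mult.commute)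
    also have "\<dots> = ?F $$ (i, j)"
      using ij by (auto simp: row_def nth_append poly_monom px qy vandermonde_mat_def N_def)
    finally show "(?V * S') $$ (i, j) = ?F $$ (i, j)" .
  qed (use V S' in \<open>auto simp: N_def\<close>)
  then have "det ?V * det S' = det ?F"
    using det_mult[OF V S'] by simp
  also have "\<dots> = det ?A * det ?B"
    by (rule det_four_block_mat_upper_right_zero) auto
  also have "\<dots> = prod_list (map (poly q) xs) * vandermonde_prod xs *
      (prod_list (map (poly p) ys) * vandermonde_prod ys)"
    by (simp add: det_scale_rows det_vandermonde_mat)
  finally have eq: "det ?V * det S = \<dots>" by (simp add: det_S')
  \<comment> \<open>The product of the values of \<open>p\<close> on \<open>ys\<close> is exactly
    the cross term in the Vandermonde product of \<open>xs @ ys\<close>. Hence the right-hand side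
    of \<open>eq\<close> is \<open>det ?V\<close> times the product of the values of
    \<open>q\<close> on \<open>xs\<close>.\<close>
  have "prod_list (map (poly p) ys) = (\<Prod>y\<leftarrow>ys. \<Prod>x\<leftarrow>xs. y - x)"
    by (simp add: p_def poly_poly_of_roots[abs_def])
  also have "\<dots> = (\<Prod>x\<leftarrow>xs. \<Prod>y\<leftarrow>ys. y - x)"
    by (rule prod_list_swap)
  finally have "det ?V = vandermonde_prod xs * vandermonde_prod ys * prod_list (map (poly p) ys)"
    using det_vandermonde_mat[of "xs @ ys"] by (simp add: N_def vandermonde_prod_append)
  moreover have "det ?V \<noteq> 0"
    using det_vandermonde_mat[of "xs @ ys"] vandermonde_prod_nonzero[OF dist] by (simp add: N_def)
  moreover from eq calculation(1) have "det ?V * det S = det ?V * prod_list (map (poly q) xs)"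
    by (simp add: mult_ac)
  ultimately have "det S = prod_list (map (poly q) xs)" by simp
  then show ?thesis
    by (simp add: resultant_def S_def p_def q_def poly_poly_of_roots[abs_def])
qed

section \<open>Matrices of remainders modulo several polynomials\<close>

text \<open>Generalises \<open>row_labels\<close>: the modulus of block \<open>d\<close> is given by
  its list of roots, and the block has one label per root.\<close>

definition block_labels :: "('b \<Rightarrow> 'a list) \<Rightarrow> 'b list \<Rightarrow> ('b \<times> nat) list" where
  "block_labels f ds = concat (map (\<lambda>d. map (\<lambda>i. (d, i)) [0..<length (f d)]) ds)"

text \<open>The analogue of \<open>A_mat\<close> over a field; it is the image of
  \<open>A_mat\<close> in the complex numbers when \<open>f d\<close> lists the roots of the
  cyclotomic polynomials.\<close>

definition remainder_mat :: "('b \<Rightarrow> 'a list) \<Rightarrow> nat \<Rightarrow> 'b list \<Rightarrow> 'a :: field mat" where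
  "remainder_mat f N ds = mat (length (block_labels f ds)) N (\<lambda>(r, j).
     case block_labels f ds ! r of (d, i) \<Rightarrow>
       coeff (Polynomial.monom 1 j mod poly_of_roots (f d)) i)"

lemma length_block_labels: "length (block_labels f ds) = length (concat (map f ds))"
  by (induction ds) (simp_all add: block_labels_def)

text \<open>A power of X and its remainder modulo a polynomial take the same values at the roots of
  that polynomial.\<close>

lemma vandermonde_mat_remainder:
  fixes xs :: "'a :: field list"
  shows "vandermonde_mat (length xs) xs *
      mat (length xs) N (\<lambda>(i, j). coeff (Polynomial.monom 1 j mod poly_of_roots xs) i) =
    vandermonde_mat N xs" (is "?V * ?R = _")
proof (rule eq_matI)
  fix i j assume "i < dim_row (vandermonde_mat N xs)" "j < dim_col (vandermonde_mat N xs)"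
  then have ij: "i < length xs" "j < N" by (auto simp: vandermonde_mat_def)
  let ?f = "poly_of_roots xs" and ?g = "Polynomial.monom (1::'a) j"
  have f: "?f \<noteq> 0" "degree ?f = length xs"
    using degree_monic_poly_of_roots[of xs] by auto
  have "(?V * ?R) $$ (i, j) = (\<Sum>k = 0..<length xs. coeff (?g mod ?f) k * xs ! i ^ k)"
    using ij by (auto simp: scalar_prod_def vandermonde_mat_def mult.commute intro!: sum.cong)
  also have "\<dots> = poly (?g mod ?f) (xs ! i)"
    using degree_mod_less[OF f(1), of ?g] f(2) by (intro poly_eq_sum_atLeastLessThan) auto
  also have "\<dots> = poly (?f * (?g div ?f) + ?g mod ?f) (xs ! i)"
    unfolding poly_add poly_mult using ij by (auto simp: poly_poly_of_roots prod_list_zero_iff)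
  also have "\<dots> = xs ! i ^ j"
    by (simp add: poly_monom)
  finally show "(?V * ?R) $$ (i, j) = vandermonde_mat N xs $$ (i, j)"
    using ij by (simp add: vandermonde_mat_def)
qed (auto simp: vandermonde_mat_def)

lemma remainder_mat_carrier [simp]:
  "remainder_mat f N ds \<in> carrier_mat (length (concat (map f ds))) N"
  unfolding remainder_mat_def length_block_labels by simp

lemma remainder_mat_Cons:
  "remainder_mat f N (d # ds) =
     mat (length (f d)) N (\<lambda>(i, j). coeff (Polynomial.monom 1 j mod poly_of_roots (f d)) i)
       @\<^sub>r remainder_mat f N ds"
  by (rule eq_matI)
     (auto simp: remainder_mat_def append_rows_def block_labels_def nth_append length_concat)

lemma vandermonde_mat_append:
  "vandermonde_mat N (xs @ ys) = vandermonde_mat N xs @\<^sub>r vandermonde_mat N ys"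
  by (rule eq_matI) (auto simp: vandermonde_mat_def append_rows_def nth_append)

lemma diag_block_mat_mult_append_rows:
  assumes "A \<in> carrier_mat m m'" "B \<in> carrier_mat n n'" "C \<in> carrier_mat m' k" "D \<in> carrier_mat n' k"
  shows "four_block_mat A (0\<^sub>m m n') (0\<^sub>m n m') B * (C @\<^sub>r D) = (A * C) @\<^sub>r (B * (D :: 'a :: comm_ring_1 mat))"
proof -
  have dims: "dim_row C = m'" "dim_row D = n'" "dim_col C = k" "dim_row (A * C) = m" "dim_row (B * D) = n" "dim_col (A * C) = k"
    using assms by auto
  \<comment> \<open>\<open>append_rows\<close> is a four-block matrix whose right-hand blocks have
    no columns; this is where the zero matrices of width 0 come from.\<close>
  have "four_block_mat A (0\<^sub>m m n') (0\<^sub>m n m') B * (C @\<^sub>r D) =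
     four_block_mat (A * C + 0\<^sub>m m n' * D) (A * 0\<^sub>m m' 0 + 0\<^sub>m m n' * 0\<^sub>m n' 0)
       (0\<^sub>m n m' * C + B * D) (0\<^sub>m n m' * 0\<^sub>m m' 0 + B * 0\<^sub>m n' 0)"
    unfolding append_rows_def dims using assms by (intro mult_four_block_mat) auto
  also have "\<dots> = (A * C) @\<^sub>r (B * D)"
    unfolding append_rows_def dims
  proof (rule cong_four_block_mat)
    show "A * C + 0\<^sub>m m n' * D = A * C" using assms by simp
    show "0\<^sub>m n m' * C + B * D = B * D" using assms by simp
  qed (use assms in auto)
  finally show ?thesis .
qed

text \<open>Each diagonal block acts only on the rows of its own modulus, so
  \<open>vandermonde_mat_remainder\<close> applies block by block. The three facts share one
  induction because the dimensions of the smaller block matrix are needed for the product and the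
  determinant.\<close>

lemma diag_block_vandermonde_mult_remainder_mat:
  fixes f :: "'b \<Rightarrow> 'a :: field list"
  defines "V \<equiv> \<lambda>d. vandermonde_mat (length (f d)) (f d)"
  shows "diag_block_mat (map V ds) \<in> carrier_mat (length (concat (map f ds))) (length (concat (map f ds)))
    \<and> diag_block_mat (map V ds) * remainder_mat f N ds = vandermonde_mat N (concat (map f ds))
    \<and> det (diag_block_mat (map V ds)) = (\<Prod>d\<leftarrow>ds. vandermonde_prod (f d))"
proof (induction ds)
  case Nil
  show ?case by (auto simp: remainder_mat_def vandermonde_mat_def block_labels_def)
next
  case (Cons d ds)
  define B where "B = diag_block_mat (map V ds)"
  define n where "n = length (concat (map f ds))"
  define m where "m = length (f d)"
  define C where "C = mat m N (\<lambda>(i, j). coeff (Polynomial.monom 1 j mod poly_of_roots (f d)) i)"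
  have C: "C \<in> carrier_mat m N" by (simp add: C_def)
  have R: "remainder_mat f N ds \<in> carrier_mat n N" unfolding n_def by (rule remainder_mat_carrier)
  have V: "V d \<in> carrier_mat m m" unfolding V_def m_def by (rule vandermonde_mat_carrier)
  have B: "B \<in> carrier_mat n n" and BR: "B * remainder_mat f N ds = vandermonde_mat N (concat (map f ds))"
    and detB: "det B = (\<Prod>d\<leftarrow>ds. vandermonde_prod (f d))"
    using Cons unfolding B_def n_def by blast+
  have eq: "diag_block_mat (map V (d # ds)) = four_block_mat (V d) (0\<^sub>m m n) (0\<^sub>m n m) B"
    using V B by (simp add: Let_def B_def)
  have "diag_block_mat (map V (d # ds)) \<in> carrier_mat (m + n) (m + n)"
    unfolding eq using V B by simp
  moreover have "diag_block_mat (map V (d # ds)) * remainder_mat f N (d # ds) =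
      vandermonde_mat N (concat (map f (d # ds)))"
    unfolding eq remainder_mat_Cons C_def[symmetric, unfolded m_def]
    using diag_block_mat_mult_append_rows[OF V B C R] BR
    by (simp add: vandermonde_mat_append vandermonde_mat_remainder V_def C_def m_def)
  moreover have "det (diag_block_mat (map V (d # ds))) = det (V d) * det B"
    unfolding eq by (rule det_four_block_mat_upper_right_zero[OF V _ _ B]) auto
  ultimately show ?case
    by (simp add: detB V_def det_vandermonde_mat m_def n_def)
qed

text \<open>What is left of the Vandermonde product of the concatenation once the Vandermonde
  products of the single lists are divided out.\<close>

primrec cross_prod :: "'a list list \<Rightarrow> 'a :: comm_ring_1" where
  "cross_prod [] = 1"
| "cross_prod (xs # xss) = (\<Prod>x\<leftarrow>xs. \<Prod>y\<leftarrow>concat xss. y - x) * cross_prod xss"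

lemma vandermonde_prod_concat:
  "vandermonde_prod (concat xss) = (\<Prod>xs\<leftarrow>xss. vandermonde_prod xs) * cross_prod xss"
  by (induction xss) (simp_all add: vandermonde_prod_append mult_ac)

text \<open>Take determinants in the block identity and cancel the Vandermonde products of the
  single blocks, which are nonzero by distinctness.\<close>

lemma det_remainder_mat:
  fixes f :: "'b \<Rightarrow> 'a :: field list"
  assumes "distinct (concat (map f ds))" and N: "N = length (concat (map f ds))"
  shows "det (remainder_mat f N ds) = cross_prod (map f ds)"
proof -
  let ?B = "diag_block_mat (map (\<lambda>d. vandermonde_mat (length (f d)) (f d)) ds)"
  let ?P = "\<Prod>d\<leftarrow>ds. vandermonde_prod (f d)"
  note * = diag_block_vandermonde_mult_remainder_mat[where f = f and ds = ds and N = N, folded N]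
  have R: "remainder_mat f N ds \<in> carrier_mat N N"
    using remainder_mat_carrier[of f N ds] N by simp
  have "det ?B * det (remainder_mat f N ds) = det (vandermonde_mat N (concat (map f ds)))"
    using * det_mult[OF _ R, of ?B] by auto
  also have "\<dots> = ?P * cross_prod (map f ds)"
    unfolding N det_vandermonde_mat vandermonde_prod_concat by (simp add: o_def)
  finally have "?P * det (remainder_mat f N ds) = ?P * cross_prod (map f ds)"
    using * by simp
  moreover have "?P * cross_prod (map f ds) \<noteq> 0"
    using vandermonde_prod_nonzero[OF assms(1)] by (simp add: vandermonde_prod_concat o_def)
  ultimately show ?thesis by auto
qed

text \<open>Because \<open>ds\<close> increases, the later list belongs to the larger index. Each
  difference is therefore a root for \<open>d2\<close> minus a root for \<open>d1\<close>, the
  orientation of the resultant of Phi_d2 and Phi_d1, and no sign has to be corrected.\<close>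

lemma cross_prod_sorted:
  fixes ds :: "'b :: linorder list"
  assumes "sorted_wrt (<) ds"
  shows "cross_prod (map f ds) =
    (\<Prod>(d1, d2)\<in>{(d1, d2). d1 \<in> set ds \<and> d2 \<in> set ds \<and> d1 < d2}.
       \<Prod>x\<leftarrow>f d2. \<Prod>y\<leftarrow>f d1. x - y)"
  using assms
proof (induction ds)
  case Nil
  show ?case by simp
next
  case (Cons d ds)
  let ?P = "\<lambda>ds. {(d1, d2). d1 \<in> set ds \<and> d2 \<in> set ds \<and> d1 < d2}"
  let ?g = "\<lambda>(d1, d2). \<Prod>x\<leftarrow>f d2. \<Prod>y\<leftarrow>f d1. x - y"
  have fin: "finite (?P ds)"
    by (rule finite_subset[of _ "set ds \<times> set ds"]) auto
  have split: "?P (d # ds) = {d} \<times> set ds \<union> ?P ds"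
    using Cons.prems by (auto dest: less_asym)
  have dist: "distinct ds"
    using Cons.prems strict_sorted_iff by (auto simp: strict_sorted_iff)
  have swap: "(\<Prod>x\<leftarrow>f d. \<Prod>y\<leftarrow>zs. y - x) = (\<Prod>y\<leftarrow>zs. \<Prod>x\<leftarrow>f d. y - x)" for zs
    by (rule prod_list_swap)
  have "prod ?g (?P (d # ds)) = prod ?g ({d} \<times> set ds) * prod ?g (?P ds)"
    unfolding split using Cons.prems by (intro prod.union_disjoint fin) auto
  also have "prod ?g ({d} \<times> set ds) = (\<Prod>e\<in>set ds. ?g (d, e))"
    by (simp add: prod.cartesian_product[symmetric])
  also have "\<dots> = (\<Prod>e\<leftarrow>ds. \<Prod>x\<leftarrow>f e. \<Prod>y\<leftarrow>f d. x - y)"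
    using dist by (simp add: prod.distinct_set_conv_list)
  also have "\<dots> = (\<Prod>x\<leftarrow>f d. \<Prod>y\<leftarrow>concat (map f ds). y - x)"
    unfolding swap by (induction ds) simp_all
  finally show ?case using Cons by simp
qed

section \<open>Cyclotomic polynomials\<close>

definition unity_root :: "nat \<Rightarrow> nat \<Rightarrow> complex" where
  "unity_root n k = cis (2 * pi * real k / real n)"

text \<open>For \<open>d = 1\<close> the filter keeps \<open>k = 0\<close>, which is coprime to 1,
  and the list is \<open>[1]\<close>.\<close>

definition prim_root_list :: "nat \<Rightarrow> complex list" where
  "prim_root_list d = map (unity_root d) (filter (\<lambda>k. coprime k d) [0..<d])"

definition prim_roots :: "nat \<Rightarrow> complex set" where
  "prim_roots d = set (prim_root_list d)"

lemma unity_root_0 [simp]: "unity_root n 0 = 1"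
  by (simp add: unity_root_def)

lemma norm_unity_root [simp]: "norm (unity_root n k) = 1"
  by (simp add: unity_root_def)

lemma unity_root_power: "unity_root n k ^ m = unity_root n (k * m)"
  unfolding unity_root_def Complex.DeMoivre by (rule arg_cong[of _ _ cis]) (simp add: mult_ac)

lemma unity_root_add: "unity_root n (k + l) = unity_root n k * unity_root n l"
  by (simp add: unity_root_def cis_mult ring_distribs add_divide_distrib)

lemma unity_root_mult_cancel:
  assumes "g > 0"
  shows "unity_root (g * n) (g * k) = unity_root n k"
  using assms by (simp add: unity_root_def mult_ac)

lemma bij_betw_unity_root: "n > 0 \<Longrightarrow> bij_betw (unity_root n) {..<n} {z. z ^ n = 1}"
  using Complex.bij_betw_roots_unity[of n] by (simp add: unity_root_def[abs_def])

lemma unity_root_self: "n > 0 \<Longrightarrow> unity_root n n = 1"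
  by (simp add: unity_root_def)

lemma unity_root_mod:
  assumes "n > 0"
  shows "unity_root n (k mod n) = unity_root n k"
proof -
  have "unity_root n (n * (k div n)) = 1"
    using unity_root_self[OF assms] by (simp flip: unity_root_power)
  then have "unity_root n (n * (k div n) + k mod n) = unity_root n (k mod n)"
    by (simp only: unity_root_add mult_1_left)
  then show ?thesis by simp
qed

lemma unity_root_eq_1_iff:
  assumes "n > 0"
  shows "unity_root n k = 1 \<longleftrightarrow> n dvd k"
proof -
  have "unity_root n k = 1 \<longleftrightarrow> unity_root n (k mod n) = unity_root n 0"
    using assms by (simp add: unity_root_mod)
  also have "\<dots> \<longleftrightarrow> k mod n = 0"
    using bij_betw_unity_root[OF assms] assms by (intro inj_on_eq_iff) (auto simp: bij_betw_def)
  finally show ?thesis by (simp add: dvd_eq_mod_eq_0)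
qed

lemma finite_prim_roots [simp]: "finite (prim_roots d)"
  by (simp add: prim_roots_def)

lemma prim_roots_altdef: "prim_roots d = unity_root d ` {k. k < d \<and> coprime k d}"
  by (auto simp: prim_roots_def prim_root_list_def)

lemma distinct_prim_root_list: "distinct (prim_root_list d)"
proof (cases "d = 0")
  case False
  then have "inj_on (unity_root d) {..<d}"
    using bij_betw_unity_root[of d] by (auto simp: bij_betw_def)
  then show ?thesis
    by (auto simp: prim_root_list_def distinct_map intro: inj_on_subset)
qed (simp add: prim_root_list_def)

lemma length_prim_root_list: "length (prim_root_list d) = totient d"
proof -
  have "length (prim_root_list d) = card {k. k < d \<and> coprime k d}"
  proof -
    have "distinct (filter (\<lambda>k. coprime k d) [0..<d])" by simp
    from distinct_card[OF this] show ?thesis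
      by (simp add: prim_root_list_def conj_commute)
  qed
  \<comment> \<open>\<open>totatives d\<close> lies between 1 and \<open>d\<close>, the set here
    between 0 and \<open>d - 1\<close>. For \<open>d > 1\<close> neither 0 nor \<open>d\<close> is
    coprime to \<open>d\<close>; for \<open>d = 1\<close> the element 0 takes the place of
    1.\<close>
  also have "\<dots> = totient d"
  proof (cases "d \<le> 1")
    case True
    then consider "d = 0" | "d = 1" by linarith
    then show ?thesis
    proof cases
      case 2
      then have "{k. k < d \<and> coprime k d} = {0}" by auto
      then show ?thesis using 2 by simp
    qed auto
  next
    case False
    then have "{k. k < d \<and> coprime k d} = totatives d"
      by (auto simp: totatives_def le_less intro!: Nat.gr0I)
    then show ?thesis by (simp add: totient_def)
  qed
  finally show ?thesis .
qed

lemma prim_roots_power_eq_1_iff: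
  assumes "z \<in> prim_roots d"
  shows "z ^ m = 1 \<longleftrightarrow> d dvd m"
proof -
  from assms obtain k where k: "k < d" "coprime k d" "z = unity_root d k"
    by (auto simp: prim_roots_altdef)
  then have "z ^ m = 1 \<longleftrightarrow> d dvd k * m"
    by (simp add: unity_root_power unity_root_eq_1_iff)
  also have "\<dots> \<longleftrightarrow> d dvd m"
    using k(2) by (simp add: coprime_dvd_mult_right_iff coprime_commute)
  finally show ?thesis .
qed

lemma prim_roots_eqD:
  assumes "z \<in> prim_roots d" "z \<in> prim_roots e"
  shows "d = e"
  using assms[THEN prim_roots_power_eq_1_iff, of d] assms[THEN prim_roots_power_eq_1_iff, of e]
  by (auto intro: dvd_antisym)

text \<open>In lowest terms \<open>k / n\<close> is \<open>l / e\<close> with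
  \<open>e = n div gcd k n\<close>; reducing \<open>l\<close> modulo \<open>e\<close> brings it into
  the range used by \<open>prim_roots\<close>.\<close>

lemma unity_root_in_prim_roots:
  assumes "n > 0"
  shows "unity_root n k \<in> prim_roots (n div gcd k n)"
proof -
  define g where "g = gcd k n"
  define e where "e = n div g"
  define l where "l = k div g"
  have g: "g > 0" "n = g * e" "k = g * l" using assms by (auto simp: g_def e_def l_def)
  have e: "e > 0" using assms g by (auto intro!: Nat.gr0I)
  have "coprime l e" unfolding l_def e_def g_def using assms by (intro div_gcd_coprime) auto
  then have "coprime (l mod e) e" using e by (simp add: coprime_iff_gcd_eq_1)
  moreover have "unity_root n k = unity_root e (l mod e)"
    using unity_root_mult_cancel[OF g(1), of e l] g e by (simp add: unity_root_mod)
  ultimately show ?thesis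
    using e by (auto simp: prim_roots_altdef e_def[symmetric] g_def[symmetric])
qed

text \<open>Each \<open>n\<close>-th root of unity has exactly one order, and it divides
  \<open>n\<close>. The order is kept as a separate component so that sums whose terms depend on it
  can be reindexed too.\<close>

lemma bij_betw_prim_roots:
  assumes n: "n > 0"
  shows "bij_betw (\<lambda>k. (n div gcd k n, unity_root n k)) {..<n} (SIGMA d:{d. d dvd n}. prim_roots d)"
proof -
  have "inj_on (\<lambda>k. (n div gcd k n, unity_root n k)) {..<n}"
    using bij_betw_unity_root[OF n] by (auto simp: bij_betw_def inj_on_def)
  moreover have "(\<lambda>k. (n div gcd k n, unity_root n k)) ` {..<n} = (SIGMA d:{d. d dvd n}. prim_roots d)"
  proof (intro equalityI subsetI)
    fix x assume "x \<in> (\<lambda>k. (n div gcd k n, unity_root n k)) ` {..<n}"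
    then obtain k where k: "x = (n div gcd k n, unity_root n k)" by blast
    have "n div gcd k n dvd n" using div_dvd_iff_mult[of "gcd k n" n n] n by auto
    then show "x \<in> (SIGMA d:{d. d dvd n}. prim_roots d)"
      using unity_root_in_prim_roots[OF n, of k] k by auto
  next
    fix x assume "x \<in> (SIGMA d:{d. d dvd n}. prim_roots d)"
    then obtain d z where x: "x = (d, z)" "d dvd n" "z \<in> prim_roots d" by auto
    then have "z ^ n = 1" by (simp add: prim_roots_power_eq_1_iff)
    then obtain k where k: "k < n" "z = unity_root n k"
      using bij_betw_unity_root[OF n] by (auto simp: bij_betw_def)
    then have "d = n div gcd k n"
      using x unity_root_in_prim_roots[OF n, of k] prim_roots_eqD by blast
    then show "x \<in> (\<lambda>k. (n div gcd k n, unity_root n k)) ` {..<n}"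
      using x k by auto
  qed
  ultimately show ?thesis by (simp add: bij_betw_def)
qed

lemma sum_prim_roots:
  assumes "n > 0"
  shows "(\<Sum>d | d dvd n. \<Sum>z\<in>prim_roots d. g d z) = (\<Sum>k<n. g (n div gcd k n) (unity_root n k))"
  using sum.reindex_bij_betw[OF bij_betw_prim_roots[OF assms], of "case_prod g"] assms
  by (simp add: sum.Sigma)

lemma prod_prim_roots:
  assumes "n > 0"
  shows "(\<Prod>d | d dvd n. \<Prod>z\<in>prim_roots d. g z) = (\<Prod>z | z ^ n = 1. g z)"
proof -
  have "(\<Prod>d | d dvd n. \<Prod>z\<in>prim_roots d. g z) = (\<Prod>k<n. g (unity_root n k))"
    using prod.reindex_bij_betw[OF bij_betw_prim_roots[OF assms], of "\<lambda>(d, z). g z"] assms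
    by (simp add: prod.Sigma)
  also have "\<dots> = (\<Prod>z | z ^ n = 1. g z)"
    by (rule prod.reindex_bij_betw[OF bij_betw_unity_root[OF assms]])
  finally show ?thesis .
qed

section \<open>Factorisation of X^n - 1 and integrality of the cyclotomic polynomials\<close>

lemma cyclotomic_complex_eq: "cyclotomic_complex d = poly_of_roots (prim_root_list d)"
  by (simp add: cyclotomic_complex_def poly_of_roots_def prim_root_list_def unity_root_def[abs_def]
      o_def conj_commute flip: prod.distinct_set_conv_list)

lemma cyclotomic_complex_prod: "cyclotomic_complex d = (\<Prod>z\<in>prim_roots d. [:- z, 1:])"
  by (simp add: cyclotomic_complex_eq poly_of_roots_def prim_roots_def
      prod.distinct_set_conv_list distinct_prim_root_list)

lemma cyclotomic_complex_degree_monic: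
  "degree (cyclotomic_complex d) = totient d" "lead_coeff (cyclotomic_complex d) = 1"
  unfolding cyclotomic_complex_eq
  by (simp add: degree_monic_poly_of_roots length_prim_root_list)
     (rule conjunct2[OF degree_monic_poly_of_roots])

text \<open>Both sides have degree at most \<open>n\<close>, the same coefficient at X^n, and vanish
  at the \<open>n\<close> roots of unity.\<close>

lemma prod_roots_unity_linear:
  assumes "n > 0"
  shows "(\<Prod>z | z ^ n = 1. [:- z, 1:]) = (Polynomial.monom 1 n - 1 :: complex poly)" (is "?L = ?R")
proof (rule poly_eqI_degree_lead_coeff[of _ n _ "{z. z ^ n = 1}"])
  have fin: "finite {z::complex. z ^ n = 1}" using assms by (intro finite_roots_unity) auto
  have deg: "degree ?L = n"
    using assms by (subst degree_prod_eq_sum_degree) (auto simp: card_roots_unity_eq)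
  show "degree ?L \<le> n" using deg by simp
  have "lead_coeff ?L = 1" by (simp add: lead_coeff_prod)
  then show "coeff ?L n = coeff ?R n"
    using assms by (simp add: deg)
  show "n \<le> card {z::complex. z ^ n = 1}" using assms by (simp add: card_roots_unity_eq)
  show "degree ?R \<le> n" by (intro degree_diff_le degree_monom_le) auto
  fix w :: complex assume "w \<in> {z. z ^ n = 1}"
  then show "poly ?L w = poly ?R w"
    using fin by (auto simp: poly_prod poly_monom)
qed

lemma prod_cyclotomic_complex:
  assumes "n > 0"
  shows "(\<Prod>d | d dvd n. cyclotomic_complex d) = Polynomial.monom 1 n - 1"
  unfolding cyclotomic_complex_prod prod_prim_roots[OF assms] prod_roots_unity_linear[OF assms] ..

text \<open>Pseudo-division scales \<open>f\<close> by a power of the leading coefficient of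
  \<open>g\<close>, which is 1 here.\<close>

lemma monic_division_exists:
  fixes f g :: "int poly"
  assumes "lead_coeff g = 1"
  obtains q r where "f = g * q + r" "r = 0 \<or> degree r < degree g"
proof -
  obtain q r where qr: "pseudo_divmod f g = (q, r)" by force
  have "g \<noteq> 0" using assms by auto
  from pseudo_divmod[OF this qr] show ?thesis using that assms by simp
qed

lemma dvd_degree_less_eq_0:
  fixes g r :: "'a :: idom poly"
  assumes "g dvd r" "r = 0 \<or> degree r < degree g"
  shows "r = 0"
  using assms dvd_imp_degree_le[of g r] by force

text \<open>Division by a monic polynomial stays within the integers, and uniqueness of the
  remainder identifies it with the complex one.\<close>

lemma int_poly_rem_complex:
  fixes f g :: "int poly"
  assumes g: "lead_coeff g = 1"
  shows "of_int_poly (int_poly_rem f g) = (of_int_poly f mod of_int_poly g :: complex poly)"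
proof -
  obtain q r where qr: "f = g * q + r" "r = 0 \<or> degree r < degree g"
    by (rule monic_division_exists[OF g])
  have "int_poly_rem f g = r"
    unfolding int_poly_rem_def
  proof (rule the_equality)
    show "(r = 0 \<or> degree r < degree g) \<and> g dvd f - r" using qr by simp
    fix s assume s: "(s = 0 \<or> degree s < degree g) \<and> g dvd f - s"
    moreover have "g dvd f - r" using qr by simp
    ultimately have "g dvd (f - s) - (f - r)" by (meson dvd_diff)
    then have "g dvd r - s" by simp
    moreover have "r - s = 0 \<or> degree (r - s) < degree g"
      using s qr(2) degree_diff_less[of r "degree g" s] by (cases "r = 0"; cases "s = 0") auto
    ultimately show "s = r" using dvd_degree_less_eq_0[of g "r - s"] by simp
  qed
  moreover have "(of_int_poly f :: complex poly) = of_int_poly g * of_int_poly q + of_int_poly r"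
    by (simp add: qr(1) hom_distribs)
  moreover have "of_int_poly r mod of_int_poly g = (of_int_poly r :: complex poly)"
    using qr(2) by (auto intro: mod_poly_less)
  ultimately show ?thesis by simp
qed

text \<open>By induction the product \<open>C\<close> of the factors for proper divisors of
  \<open>n\<close> comes from a monic integer polynomial \<open>Q\<close>. Divide X^n - 1 by
  \<open>Q\<close> over the integers: over the complex numbers \<open>C\<close> divides the
  remainder, whose degree is smaller, so the remainder is 0 and the quotient is the cyclotomic
  polynomial.\<close>

lemma cyclotomic_integral:
  assumes "n > 0"
  shows "\<exists>p. of_int_poly p = cyclotomic_complex n"
  using assms
proof (induction n rule: less_induct)
  case (less n)
  let ?D = "{d. d dvd n \<and> d \<noteq> n}"
  have "\<exists>p. of_int_poly p = cyclotomic_complex d" if "d \<in> ?D" for d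
  proof (rule less.IH)
    show "d > 0" using that less.prems by (auto intro: Nat.gr0I)
    show "d < n" using that less.prems dvd_imp_le[of d n] by auto
  qed
  then obtain P where P: "\<And>d. d \<in> ?D \<Longrightarrow> of_int_poly (P d) = cyclotomic_complex d" by metis
  define Q where "Q = (\<Prod>d\<in>?D. P d)"
  define C where "C = (\<Prod>d\<in>?D. cyclotomic_complex d)"
  have QC: "of_int_poly Q = C" by (simp add: Q_def C_def hom_distribs P)
  have "lead_coeff C = 1"
    by (simp add: C_def lead_coeff_prod cyclotomic_complex_degree_monic(2))
  moreover have "lead_coeff C = of_int (lead_coeff Q)"
    by (simp flip: QC)
  ultimately have monic: "lead_coeff Q = 1" "C \<noteq> 0" by auto
  have "{d. d dvd n} = insert n ?D" "finite ?D" using less.prems by auto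
  then have "Polynomial.monom 1 n - 1 = C * cyclotomic_complex n"
    using less.prems by (subst prod_cyclotomic_complex[symmetric]) (simp_all add: C_def mult.commute)
  moreover obtain q r where qr: "Polynomial.monom 1 n - 1 = Q * q + r" "r = 0 \<or> degree r < degree Q"
    by (rule monic_division_exists[OF monic(1)])
  from arg_cong[OF this(1), of "of_int_poly :: int poly \<Rightarrow> complex poly"]
  have "(Polynomial.monom 1 n - 1 :: complex poly) = C * of_int_poly q + of_int_poly r"
    by (simp add: hom_distribs QC)
  ultimately have "C * cyclotomic_complex n = C * of_int_poly q + of_int_poly r"
    by (rule trans[OF sym])
  then have eq: "C * (cyclotomic_complex n - of_int_poly q) = of_int_poly r"
    by (simp only: right_diff_distrib add_diff_cancel_left')
  have "(of_int_poly r :: complex poly) = 0"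
  proof (rule dvd_degree_less_eq_0[of C])
    show "C dvd of_int_poly r" unfolding eq[symmetric] by (rule dvd_triv_left)
    show "(of_int_poly r :: complex poly) = 0 \<or> degree (of_int_poly r :: complex poly) < degree C"
      using qr(2) by (auto simp flip: QC)
  qed
  then have "cyclotomic_complex n = of_int_poly q" using eq monic(2) by simp
  then show ?case by metis
qed

lemma of_int_poly_cyclotomic:
  assumes "n > 0"
  shows "of_int_poly (cyclotomic n) = cyclotomic_complex n"
proof -
  obtain p where p: "of_int_poly p = cyclotomic_complex n"
    using cyclotomic_integral[OF assms] by blast
  have "cyclotomic n = p"
    unfolding cyclotomic_def p[symmetric] by (rule the_equality) auto
  then show ?thesis using p by simp
qed

lemma lead_coeff_cyclotomic:
  assumes "n > 0"
  shows "lead_coeff (cyclotomic n) = 1"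
proof -
  have "of_int (lead_coeff (cyclotomic n)) = lead_coeff (cyclotomic_complex n)"
    by (simp flip: of_int_poly_cyclotomic[OF assms])
  then have "complex_of_int (lead_coeff (cyclotomic n)) = of_int 1"
    by (simp only: cyclotomic_complex_degree_monic(2) of_int_1)
  then show ?thesis by (simp only: of_int_eq_iff)
qed

section \<open>The determinant of A_n as a product of resultants\<close>

lemma resultant_cyclotomic:
  assumes "d > 0" "e > 0" "d \<noteq> e"
  shows "of_int (resultant (cyclotomic d) (cyclotomic e)) =
    (\<Prod>x\<leftarrow>prim_root_list d. \<Prod>y\<leftarrow>prim_root_list e. x - y)"
proof -
  have "of_int (resultant (cyclotomic d) (cyclotomic e)) =
      resultant (cyclotomic_complex d) (cyclotomic_complex e)"
    using assms by (simp flip: of_int_hom.resultant_hom add: of_int_poly_cyclotomic)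
  moreover have "distinct (prim_root_list d @ prim_root_list e)"
    using assms(3) prim_roots_eqD by (auto simp: distinct_prim_root_list simp flip: prim_roots_def)
  ultimately show ?thesis
    by (simp add: cyclotomic_complex_eq resultant_poly_of_roots)
qed

lemma set_divisors_sorted:
  assumes "n > 0"
  shows "set (divisors_sorted n) = {d. d dvd n}" "sorted_wrt (<) (divisors_sorted n)"
  using assms by (simp_all add: divisors_sorted_def)

lemma length_concat_prim_root_list:
  assumes "n > 0"
  shows "length (concat (map prim_root_list (divisors_sorted n))) = n"
proof -
  have "length (concat (map prim_root_list (divisors_sorted n))) = (\<Sum>d\<leftarrow>divisors_sorted n. totient d)"
    by (simp add: length_concat length_prim_root_list o_def)
  also have "\<dots> = (\<Sum>d | d dvd n. totient d)"
    using assms by (simp add: sum_list_distinct_conv_sum_set set_divisors_sorted divisors_sorted_def)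
  finally show ?thesis by (simp add: totient_divisor_sum)
qed

text \<open>Taking remainders commutes with the passage to complex coefficients since the cyclotomic
  polynomials are monic; the labels agree because block \<open>d\<close> has
  \<open>totient d\<close> roots.\<close>

lemma map_mat_A_mat:
  assumes n: "n > 0"
  shows "map_mat of_int (A_mat n) = remainder_mat prim_root_list n (divisors_sorted n)"
proof -
  have labels: "row_labels n = block_labels prim_root_list (divisors_sorted n)"
    by (simp add: row_labels_def block_labels_def length_prim_root_list)
  have len: "length (row_labels n) = n"
    using length_concat_prim_root_list[OF n] by (simp add: labels length_block_labels)
  have "of_int (coeff (int_poly_rem (Polynomial.monom 1 j) (cyclotomic d)) i) =
      coeff (Polynomial.monom 1 j mod poly_of_roots (prim_root_list d)) i"
    if "(d, i) \<in> set (row_labels n)" for d i j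
  proof -
    have "d dvd n" using that n by (auto simp: row_labels_def set_divisors_sorted)
    then have d: "d > 0" using n by (rule dvd_pos_nat[rotated])
    show ?thesis
      using int_poly_rem_complex[OF lead_coeff_cyclotomic[OF d], of "Polynomial.monom 1 j"]
      by (simp add: of_int_poly_cyclotomic[OF d] flip: cyclotomic_complex_eq of_int_hom.coeff_map_poly_hom)
  qed
  moreover have "row_labels n ! i \<in> set (row_labels n)" if "i < n" for i
    using that len by simp
  ultimately have entry: "of_int (case row_labels n ! i of (d, i) \<Rightarrow>
      coeff (int_poly_rem (Polynomial.monom 1 j) (cyclotomic d)) i) =
    (case row_labels n ! i of (d, i) \<Rightarrow>
      coeff (Polynomial.monom 1 j mod poly_of_roots (prim_root_list d)) i)" if "i < n" for i j
    using that by (metis (mono_tags, lifting) case_prod_unfold prod.collapse)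
  show ?thesis
  proof (rule eq_matI)
    fix i j
    assume "i < dim_row (remainder_mat prim_root_list n (divisors_sorted n))"
      "j < dim_col (remainder_mat prim_root_list n (divisors_sorted n))"
    then have "i < n" "j < n" using len by (auto simp: remainder_mat_def labels)
    then show "map_mat of_int (A_mat n) $$ (i, j) =
        remainder_mat prim_root_list n (divisors_sorted n) $$ (i, j)"
      using len entry by (simp add: A_mat_def remainder_mat_def flip: labels)
  qed (use len in \<open>simp_all add: A_mat_def remainder_mat_def labels\<close>)
qed

lemma det_A_mat:
  assumes n: "n > 0"
  shows "det (A_mat n) =
    (\<Prod>(d1, d2)\<in>{(d1, d2). d1 dvd n \<and> d2 dvd n \<and> d1 < d2}. resultant (cyclotomic d2) (cyclotomic d1))"
proof -
  let ?ds = "divisors_sorted n"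
  have dist: "distinct (concat (map prim_root_list ?ds))"
  proof (rule distinct_concat)
    \<comment> \<open>Each list has an entry because \<open>totient d > 0\<close>, and the order of
      that entry recovers \<open>d\<close>.\<close>
    have "inj_on prim_root_list {d. d dvd n}"
    proof (rule inj_onI)
      fix d e assume de: "d \<in> {d. d dvd n}" "prim_root_list d = prim_root_list e"
      then have "length (prim_root_list d) \<noteq> 0"
        using n unfolding length_prim_root_list by auto
      then have "hd (prim_root_list d) \<in> prim_roots d" by (simp add: prim_roots_def)
      then show "d = e" using de prim_roots_eqD by (auto simp: prim_roots_def)
    qed
    then show "distinct (map prim_root_list ?ds)"
      using set_divisors_sorted[OF n] by (simp add: distinct_map strict_sorted_iff)
  qed (use prim_roots_eqD in \<open>auto simp: distinct_prim_root_list prim_roots_def\<close>)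
  have "of_int (det (A_mat n)) = det (remainder_mat prim_root_list n ?ds)"
    by (simp add: map_mat_A_mat[OF n, symmetric] of_int_hom.hom_det)
  also have "\<dots> = cross_prod (map prim_root_list ?ds)"
    by (rule det_remainder_mat[OF dist]) (simp add: length_concat_prim_root_list[OF n])
  also have "\<dots> = (\<Prod>(d1, d2)\<in>{(d1, d2). d1 dvd n \<and> d2 dvd n \<and> d1 < d2}.
      of_int (resultant (cyclotomic d2) (cyclotomic d1)))"
    unfolding cross_prod_sorted[OF set_divisors_sorted(2)[OF n]] set_divisors_sorted(1)[OF n]
    using n by (intro prod.cong) (auto simp: resultant_cyclotomic dvd_pos_nat)
  finally show ?thesis
    by (simp add: case_prod_unfold flip: of_int_prod)
qed

section \<open>Sign and logarithm of a single resultant\<close>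

text \<open>Describes membership by powers alone, a condition that complex conjugation visibly
  preserves.\<close>

lemma prim_roots_iff:
  assumes "d > 0"
  shows "z \<in> prim_roots d \<longleftrightarrow> (\<forall>m. z ^ m = 1 \<longleftrightarrow> d dvd m)"
proof
  assume *: "\<forall>m. z ^ m = 1 \<longleftrightarrow> d dvd m"
  then have "z ^ d = 1" by simp
  then obtain k where "z = unity_root d k"
    using bij_betw_unity_root[OF assms] by (auto simp: bij_betw_def)
  then obtain e where e: "z \<in> prim_roots e"
    using unity_root_in_prim_roots[OF assms] by blast
  then have "d = e"
    using * prim_roots_power_eq_1_iff[OF e] by (metis dvd_antisym dvd_refl)
  with e show "z \<in> prim_roots d" by simp
qed (auto simp: prim_roots_power_eq_1_iff)

lemma cnj_prim_roots:
  assumes "d > 0" "z \<in> prim_roots d"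
  shows "cnj z \<in> prim_roots d"
proof -
  have "cnj z ^ m = 1 \<longleftrightarrow> z ^ m = 1" for m
    by (metis complex_cnj_cnj complex_cnj_one complex_cnj_power)
  then show ?thesis using assms by (simp add: prim_roots_iff)
qed

text \<open>A real root of unity is 1 or -1 and so has order at most 2.\<close>

lemma Im_prim_root_nonzero:
  assumes "d > 2" "z \<in> prim_roots d"
  shows "Im z \<noteq> 0"
proof
  assume "Im z = 0"
  moreover have "norm z = 1" using assms by (auto simp: prim_roots_altdef)
  ultimately have "\<bar>Re z\<bar> = 1" by (simp add: cmod_eq_Re)
  then have "Re z = 1 \<or> Re z = -1" by linarith
  with \<open>Im z = 0\<close> have "z ^ 2 = 1" by (auto simp: complex_eq_iff power2_eq_square)
  then have "d dvd 2" using assms by (simp add: prim_roots_power_eq_1_iff)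
  then show False using assms(1) by (auto dest: dvd_imp_le)
qed

lemma of_int_resultant_cyclotomic:
  assumes "d > 0" "e > 0" "d \<noteq> e"
  shows "of_int (resultant (cyclotomic d) (cyclotomic e)) = (\<Prod>x\<in>prim_roots d. \<Prod>y\<in>prim_roots e. x - y)"
  using resultant_cyclotomic[OF assms]
  by (simp add: prim_roots_def prod.distinct_set_conv_list distinct_prim_root_list)

text \<open>The roots of Phi_d split into \<open>A\<close> in the upper half plane and the
  conjugates of \<open>A\<close>. As the roots of Phi_e are closed under conjugation,
  \<open>P\<close> commutes with it, and the resultant is the squared absolute value of the product
  of \<open>P\<close> over \<open>A\<close>.\<close>

lemma resultant_cyclotomic_nonneg:
  assumes d: "d > 2" and e: "e > 0" "d \<noteq> e"
  shows "resultant (cyclotomic d) (cyclotomic e) \<ge> 0"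
proof -
  define P where "P = (\<lambda>x. \<Prod>y\<in>prim_roots e. x - y)"
  define A where "A = {x \<in> prim_roots d. Im x > 0}"
  have P_cnj: "P (cnj x) = cnj (P x)" for x
  proof -
    have "bij_betw cnj (prim_roots e) (prim_roots e)"
      by (rule bij_betwI[of _ _ _ cnj]) (auto intro: cnj_prim_roots e)
    from prod.reindex_bij_betw[OF this, of "\<lambda>y. cnj x - y"] show ?thesis
      by (simp add: P_def)
  qed
  have union: "prim_roots d = A \<union> cnj ` A"
  proof (intro equalityI subsetI)
    fix x assume x: "x \<in> prim_roots d"
    then consider "Im x > 0" | "Im x < 0" using Im_prim_root_nonzero[OF d] by force
    then show "x \<in> A \<union> cnj ` A"
    proof cases
      case 2
      then have "cnj x \<in> A" using x d by (simp add: A_def cnj_prim_roots)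
      then show ?thesis by (metis UnI2 complex_cnj_cnj imageI)
    qed (use x in \<open>simp add: A_def\<close>)
  qed (use d in \<open>auto simp: A_def cnj_prim_roots\<close>)
  have "of_int (resultant (cyclotomic d) (cyclotomic e)) = (\<Prod>x\<in>prim_roots d. P x)"
    using d e by (simp add: of_int_resultant_cyclotomic P_def)
  also have "\<dots> = (\<Prod>x\<in>A. P x) * (\<Prod>x\<in>cnj ` A. P x)"
    unfolding union by (rule prod.union_disjoint) (auto simp: A_def)
  also have "(\<Prod>x\<in>cnj ` A. P x) = cnj (\<Prod>x\<in>A. P x)"
    by (subst prod.reindex) (auto simp: inj_on_def P_cnj)
  also have "(\<Prod>x\<in>A. P x) * cnj (\<Prod>x\<in>A. P x) = of_real ((norm (\<Prod>x\<in>A. P x))\<^sup>2)"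
    by (rule complex_norm_square[symmetric])
  finally have "real_of_int (resultant (cyclotomic d) (cyclotomic e)) = (norm (\<Prod>x\<in>A. P x))\<^sup>2"
    by (metis of_real_eq_iff of_real_of_int_eq)
  then have "real_of_int (resultant (cyclotomic d) (cyclotomic e)) \<ge> 0" by simp
  then show ?thesis by linarith
qed

lemma resultant_cyclotomic_2_1: "resultant (cyclotomic 2) (cyclotomic 1) = -2"
proof -
  have "prim_root_list 2 = [-1]"
    by (simp add: prim_root_list_def upt_rec numeral_2_eq_2[symmetric] unity_root_def)
  moreover have "prim_root_list 1 = [1]"
    by (simp add: prim_root_list_def)
  ultimately have "complex_of_int (resultant (cyclotomic 2) (cyclotomic 1)) = of_int (-2)"
    by (simp add: resultant_cyclotomic)
  then show ?thesis by (simp only: of_int_eq_iff)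
qed

lemma resultant_cyclotomic_nonzero:
  assumes "d > 0" "e > 0" "d \<noteq> e"
  shows "resultant (cyclotomic d) (cyclotomic e) \<noteq> 0"
proof -
  have "complex_of_int (resultant (cyclotomic d) (cyclotomic e)) \<noteq> 0"
    unfolding of_int_resultant_cyclotomic[OF assms]
    using assms prim_roots_eqD by (auto simp: prod_zero_iff)
  then show ?thesis by simp
qed

lemma ln_abs_resultant_cyclotomic:
  assumes "d > 0" "e > 0" "d \<noteq> e"
  shows "ln \<bar>real_of_int (resultant (cyclotomic d) (cyclotomic e))\<bar> =
    (\<Sum>x\<in>prim_roots d. \<Sum>y\<in>prim_roots e. ln (norm (x - y)))"
proof -
  have nz: "norm (x - y) \<noteq> 0" if "x \<in> prim_roots d" "y \<in> prim_roots e" for x y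
    using that assms prim_roots_eqD by auto
  have "\<bar>real_of_int (resultant (cyclotomic d) (cyclotomic e))\<bar> =
      norm (complex_of_int (resultant (cyclotomic d) (cyclotomic e)))" by simp
  also have "\<dots> = (\<Prod>x\<in>prim_roots d. \<Prod>y\<in>prim_roots e. norm (x - y))"
    unfolding of_int_resultant_cyclotomic[OF assms] by (simp add: prod_norm)
  also have "ln \<dots> = (\<Sum>x\<in>prim_roots d. ln (\<Prod>y\<in>prim_roots e. norm (x - y)))"
    using nz by (intro ln_prod) (auto simp: prod_zero_iff)
  also have "\<dots> = (\<Sum>x\<in>prim_roots d. \<Sum>y\<in>prim_roots e. ln (norm (x - y)))"
    using nz by (intro sum.cong ln_prod) auto
  finally show ?thesis .
qed

section \<open>The absolute value of the product of resultants\<close>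

text \<open>Add to \<open>u\<close> the product of \<open>e\<close> and all primes of
  \<open>n\<close> that do not divide \<open>u\<close>. A prime of \<open>n\<close> dividing
  \<open>u\<close> divides neither \<open>e\<close> nor \<open>t\<close>; any other prime of
  \<open>n\<close> divides \<open>t\<close> but not \<open>u\<close>. So none divides the
  sum.\<close>

lemma coprime_lift:
  fixes u e n :: nat
  assumes "coprime u e" "n > 0"
  obtains v where "[v = u] (mod e)" "coprime v n"
proof -
  define t where "t = \<Prod>{p \<in> prime_factors n. \<not> p dvd u}"
  define v where "v = u + e * t"
  have "\<not> p dvd v" if p: "prime p" "p dvd n" for p
  proof (cases "p dvd u")
    case True
    have "\<not> p dvd e" using True assms(1) p(1) by (meson coprime_common_divisor not_prime_unit)
    moreover have "\<not> p dvd t"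
    proof
      assume "p dvd t"
      then obtain q where q: "q \<in> prime_factors n" "\<not> q dvd u" "p dvd q"
        unfolding t_def using prime_dvd_prod_iff[of "{p \<in> prime_factors n. \<not> p dvd u}" p id] p(1)
        by auto
      then have "p = q" using p(1) by (auto intro: primes_dvd_imp_eq)
      with q True show False by simp
    qed
    ultimately show ?thesis
      using True p(1) by (simp add: v_def dvd_add_right_iff prime_dvd_mult_iff)
  next
    case False
    then have "p dvd t" unfolding t_def
      using p assms(2) by (intro dvd_prodI[where f = id, simplified]) (auto simp: in_prime_factors_iff)
    then show ?thesis using False by (simp add: v_def dvd_add_left_iff)
  qed
  then have "coprime v n"
    unfolding coprime_iff_gcd_eq_1 by (metis gcd_dvd1 gcd_dvd2 dvd_trans prime_factor_nat)
  moreover have "[v = u] (mod e)" by (simp add: v_def cong_def)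
  ultimately show ?thesis using that by blast
qed

lemma bij_betw_affine_mod:
  fixes n u c :: nat
  assumes "n > 0" "coprime u n"
  shows "bij_betw (\<lambda>k. (u * k + c) mod n) {..<n} {..<n}"
proof -
  have "inj_on (\<lambda>k. (u * k + c) mod n) {..<n}"
  proof (rule inj_onI)
    fix k l assume kl: "k \<in> {..<n}" "l \<in> {..<n}" "(u * k + c) mod n = (u * l + c) mod n"
    then have "[u * k + c = u * l + c] (mod n)" by (simp add: cong_def)
    then have "[k = l] (mod n)"
      using assms(2) by (simp add: cong_add_rcancel_nat cong_mult_lcancel_nat)
    then show "k = l" using kl by (auto intro: cong_less_modulus_unique_nat)
  qed
  moreover have "(\<lambda>k. (u * k + c) mod n) ` {..<n} \<subseteq> {..<n}" using assms(1) by auto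
  ultimately show ?thesis
    unfolding bij_betw_def by (intro conjI endo_inj_surj) auto
qed

text \<open>The \<open>k\<close>-th of the \<open>n\<close>-th roots of unity has order
  \<open>n div gcd k n\<close>, so this counts the \<open>n\<close>-th roots of unity whose order
  changes on multiplication by the \<open>c\<close>-th one.\<close>

definition gcd_changes :: "nat \<Rightarrow> nat \<Rightarrow> nat" where
  "gcd_changes n c = card {k. k < n \<and> gcd k n \<noteq> gcd (k + c) n}"

text \<open>If \<open>gcd c n = gcd d n\<close>, then \<open>d \<equiv> u c (mod n)\<close> for a unit \<open>u\<close> modulo \<open>n\<close>, and \<open>k \<mapsto> u k\<close> matches
  the two sets being counted.\<close>

lemma gcd_changes_cong:
  assumes n: "n > 0" and eq: "gcd c n = gcd d n"
  shows "gcd_changes n c = gcd_changes n d"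
proof -
  define g where "g = gcd c n"
  define e where "e = n div g"
  define c' d' where "c' = c div g" and "d' = d div g"
  have g: "g > 0" "n = g * e" "c = g * c'" "d = g * d'"
    using n eq by (auto simp: g_def e_def c'_def d'_def)
      (metis dvd_mult_div_cancel gcd_dvd1)
  have e: "e > 0" using n g by (auto intro!: Nat.gr0I)
  have cop: "coprime c' e" "coprime d' e"
    unfolding c'_def d'_def e_def using n div_gcd_coprime[of c n] div_gcd_coprime[of d n]
    by (simp_all add: g_def eq)
  \<comment> \<open>\<open>v\<close> inverts \<open>c'\<close> modulo \<open>e\<close>, so
    multiplication by \<open>d' * v\<close> takes \<open>c'\<close> to \<open>d'\<close> modulo
    \<open>e\<close>. This is a unit modulo \<open>e\<close> only; \<open>coprime_lift\<close>
    replaces it by a unit \<open>u\<close> modulo \<open>n\<close>.\<close>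
  obtain v where v: "[c' * v = 1] (mod e)" using cop(1) cong_solve_coprime_nat by (metis One_nat_def)
  then have "coprime v e" by (metis cong_imp_coprime cong_sym coprime_1_left coprime_mult_left_iff)
  then have "coprime (d' * v) e" using cop by simp
  then obtain u where u: "[u = d' * v] (mod e)" "coprime u n"
    using coprime_lift n by blast
  have "[c' * u = c' * (d' * v)] (mod e)" using u(1) by (rule cong_scalar_left)
  also have "c' * (d' * v) = d' * (c' * v)" by simp
  also have "[d' * (c' * v) = d' * 1] (mod e)" using v by (rule cong_scalar_left)
  finally have "[g * (c' * u) = g * d'] (mod g * e)"
    by (intro cong_cmult_leftI) simp
  then have uc: "[u * c = d] (mod n)" using g by (simp add: mult_ac)
  have gu: "gcd (u * k) n = gcd k n" for k
    using u(2) by (simp add: gcd_mult_left_left_cancel coprime_commute)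
  have guc: "gcd ((u * k + 0) mod n + d) n = gcd (k + c) n" for k
  proof -
    have "[(u * k + 0) mod n + d = u * k + u * c] (mod n)"
      using uc by (intro cong_add) (simp_all add: cong_def)
    then have "gcd ((u * k + 0) mod n + d) n = gcd (u * (k + c)) n"
      by (simp add: cong_gcd_eq distrib_left)
    then show ?thesis by (simp add: gu)
  qed
  have "bij_betw (\<lambda>k. (u * k + 0) mod n) {k \<in> {..<n}. gcd k n \<noteq> gcd (k + c) n}
      {k \<in> {..<n}. gcd k n \<noteq> gcd (k + d) n}"
    by (rule bij_betw_Collect[OF bij_betw_affine_mod[OF n u(2)]], unfold guc)
       (use n in \<open>simp add: gu\<close>)
  from bij_betw_same_card[OF this] show ?thesis
    by (simp add: gcd_changes_def)
qed

text \<open>Split \<open>d\<close> into a power \<open>p ^ t\<close> and a part \<open>e\<close>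
  prime to \<open>p\<close>. Then \<open>e\<close> divides \<open>m\<close>, and \<open>t\<close> is
  at most \<open>s\<close> because \<open>p ^ Suc s\<close> does not divide
  \<open>d\<close>.\<close>

lemma dvd_prime_power_mult_reduce:
  fixes p m d :: nat
  assumes p: "prime p" and d: "d dvd p ^ a * m" "\<not> p ^ Suc s dvd d"
  shows "d dvd p ^ s * m"
proof -
  have "d \<noteq> 0" using d by (auto intro: ccontr)
  then obtain e where e: "d = p ^ multiplicity p d * e" "\<not> p dvd e"
    using multiplicity_decompose'[of d p] p by (metis not_prime_unit)
  define t where "t = multiplicity p d"
  have "coprime e (p ^ a)"
    using e(2) p prime_imp_coprime[of p e] by (simp add: coprime_commute)
  moreover have "e dvd p ^ a * m" using d(1) e(1) by (metis dvd_mult_right)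
  ultimately have "e dvd m" by (simp add: coprime_dvd_mult_right_iff)
  moreover have "t \<le> s"
  proof (rule ccontr)
    assume "\<not> t \<le> s"
    then have "p ^ Suc s dvd p ^ t" by (intro le_imp_power_dvd) simp
    then show False using d(2) e(1) by (metis dvd_mult2 t_def)
  qed
  ultimately have "p ^ t * e dvd p ^ s * m" by (intro mult_dvd_mono le_imp_power_dvd)
  then show ?thesis using e(1) by (simp add: t_def)
qed

lemma card_multiples_lessThan:
  fixes n q :: nat
  assumes "n > 0" "q dvd n"
  shows "card {k \<in> {..<n}. q dvd k} = n div q"
proof -
  obtain r where r: "n = q * r" using assms by blast
  have q: "q > 0" using r assms by (auto intro!: Nat.gr0I)
  have "{k \<in> {..<n}. q dvd k} = (\<lambda>i. q * i) ` {..<r}"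
    using q by (auto simp: r)
  then show ?thesis using q by (simp add: card_image inj_on_def r)
qed

text \<open>With \<open>q = p ^ Suc s\<close>, the gcd changes exactly if \<open>q\<close> divides
  \<open>k\<close> or \<open>k + c\<close>. It cannot divide both, as it does not divide
  \<open>c\<close>. If it divides neither, both gcds divide \<open>c\<close>, hence each divides
  both \<open>k\<close> and \<open>k + c\<close>, and they agree. Either divisibility condition has
  \<open>n div q\<close> solutions.\<close>

lemma gcd_changes_prime_power:
  fixes p m a s :: nat
  assumes p: "prime p" and pm: "\<not> p dvd m" and s: "s < a"
  shows "gcd_changes (p ^ a * m) (p ^ s * m) = 2 * (m * p ^ (a - Suc s))"
proof -
  define n where "n = p ^ a * m"
  define c where "c = p ^ s * m"
  define q where "q = p ^ Suc s"
  have m: "m > 0" using pm by (auto intro!: Nat.gr0I)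
  have n: "n > 0" using p m by (simp add: n_def prime_gt_0_nat)
  have a: "p ^ a = q * p ^ (a - Suc s)" unfolding q_def power_add[symmetric] using s by simp
  have qn: "q dvd n" by (simp add: n_def a)
  have qc: "\<not> q dvd c"
    using pm p by (simp add: q_def c_def prime_gt_0_nat mult.commute)
  have *: "gcd k n \<noteq> gcd (k + c) n \<longleftrightarrow> q dvd k \<or> q dvd k + c" for k
  proof
    assume neq: "gcd k n \<noteq> gcd (k + c) n"
    show "q dvd k \<or> q dvd k + c"
    proof (rule ccontr)
      assume "\<not> (q dvd k \<or> q dvd k + c)"
      then have "\<not> q dvd gcd k n" "\<not> q dvd gcd (k + c) n" by auto
      moreover have "gcd l n dvd c" if "\<not> q dvd gcd l n" for l
        unfolding c_def using dvd_prime_power_mult_reduce[OF p, of "gcd l n" a m s] that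
        by (simp add: n_def q_def)
      ultimately have dvd: "gcd k n dvd c" "gcd (k + c) n dvd c" by blast+
      have "gcd k n dvd k + c" by (intro dvd_add gcd_dvd1 dvd)
      moreover have "gcd (k + c) n dvd k"
        using gcd_dvd1[of "k + c" n] dvd(2) by (simp only: dvd_add_left_iff)
      ultimately have "gcd k n = gcd (k + c) n"
        by (intro dvd_antisym gcd_greatest gcd_dvd2)
      with neq show False by simp
    qed
  next
    assume "q dvd k \<or> q dvd k + c"
    then have "q dvd gcd k n \<or> q dvd gcd (k + c) n" using qn by auto
    moreover have "\<not> (q dvd gcd k n \<and> q dvd gcd (k + c) n)"
      using qc by (auto simp: dvd_add_right_iff)
    ultimately show "gcd k n \<noteq> gcd (k + c) n" by metis
  qed
  \<comment> \<open>Since \<open>q\<close> divides \<open>n\<close>, the shift by \<open>c\<close>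
    modulo \<open>n\<close> carries the solutions of \<open>q dvd k + c\<close> onto the multiples
    of \<open>q\<close>.\<close>
  have "bij_betw (\<lambda>k. (1 * k + c) mod n) {k \<in> {..<n}. q dvd k + c} {k \<in> {..<n}. q dvd k}"
    by (rule bij_betw_Collect[OF bij_betw_affine_mod[OF n]]) (use qn in \<open>auto simp: dvd_mod_iff\<close>)
  from bij_betw_same_card[OF this] have "card {k \<in> {..<n}. q dvd k + c} = n div q"
    using card_multiples_lessThan[OF n qn] by simp
  moreover have "{k. k < n \<and> gcd k n \<noteq> gcd (k + c) n} = {k \<in> {..<n}. q dvd k} \<union> {k \<in> {..<n}. q dvd k + c}"
    unfolding * by auto
  moreover have "{k \<in> {..<n}. q dvd k} \<inter> {k \<in> {..<n}. q dvd k + c} = {}"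
    using qc by (auto simp: dvd_add_right_iff)
  ultimately have "gcd_changes n c = 2 * (n div q)"
    using card_multiples_lessThan[OF n qn] by (simp add: gcd_changes_def card_Un_disjoint)
  also have "n div q = m * p ^ (a - Suc s)"
    using p by (simp add: n_def a q_def prime_gt_0_nat mult_ac)
  finally show ?thesis by (simp add: n_def c_def)
qed

section \<open>Distances from 1 to the roots of unity, and the von Mangoldt function\<close>

text \<open>Cancel X - 1 in X^n - 1 and evaluate the quotient 1 + X + ... + X^(n-1) at 1.\<close>

lemma prod_one_minus_roots_unity:
  assumes "n > 0"
  shows "(\<Prod>z\<in>{z. z ^ n = 1} - {1}. 1 - z) = (of_nat n :: complex)"
proof -
  let ?U = "{z::complex. z ^ n = 1}"
  let ?S = "\<Sum>i<n. Polynomial.monom (1::complex) i"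
  have fin: "finite ?U" using assms by (intro finite_roots_unity) auto
  have "[:-1, 1:] * (\<Prod>z\<in>?U - {1}. [:- z, 1:]) = Polynomial.monom 1 n - 1"
    using prod.remove[OF fin, of 1 "\<lambda>z. [:- z, 1:]"] prod_roots_unity_linear[OF assms] by simp
  also have "\<dots> = [:-1, 1:] * ?S"
    by (rule poly_eq_poly_eq_iff[THEN iffD1], rule ext)
       (simp add: poly_monom poly_sum power_diff_1_eq algebra_simps)
  finally have "(\<Prod>z\<in>?U - {1}. [:- z, 1:]) = ?S"
    by (subst (asm) mult_left_cancel) auto
  from arg_cong[OF this, of "\<lambda>p. poly p 1"] show ?thesis
    by (simp add: poly_prod poly_sum poly_monom)
qed

lemma sum_ln_roots_unity:
  assumes "n > 0"
  shows "(\<Sum>z | z ^ n = 1. ln (norm (1 - z :: complex))) = ln (real n)"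
proof -
  let ?U = "{z::complex. z ^ n = 1}"
  have fin: "finite ?U" using assms by (intro finite_roots_unity) auto
  \<comment> \<open>The term at \<open>z = 1\<close> is \<open>ln 0\<close>, which is 0 by
    convention.\<close>
  have "(\<Sum>z\<in>?U. ln (norm (1 - z))) = (\<Sum>z\<in>?U - {1}. ln (norm (1 - z)))"
    using fin by (intro sum.mono_neutral_right) auto
  also have "\<dots> = ln (\<Prod>z\<in>?U - {1}. norm (1 - z))"
    using fin by (subst ln_prod) auto
  also have "(\<Prod>z\<in>?U - {1}. norm (1 - z)) = norm (\<Prod>z\<in>?U - {1}. 1 - z)"
    by (simp add: prod_norm)
  finally show ?thesis by (simp add: prod_one_minus_roots_unity[OF assms])
qed

text \<open>Summed over the divisors of \<open>n\<close>, both sides give \<open>ln n\<close>. By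
  induction they agree at the proper divisors, hence also at \<open>n\<close>.\<close>

lemma sum_ln_prim_roots:
  assumes "n > 0"
  shows "(\<Sum>z\<in>prim_roots n. ln (norm (1 - z))) = mangoldt n"
  using assms
proof (induction n rule: less_induct)
  case (less n)
  let ?S = "\<lambda>d. \<Sum>z\<in>prim_roots d. ln (norm (1 - z))"
  let ?D = "{d. d dvd n \<and> d \<noteq> n}"
  have D: "{d. d dvd n} = insert n ?D" "finite ?D" using less.prems by auto
  have "?S d = mangoldt d" if "d \<in> ?D" for d
  proof (rule less.IH)
    show "d > 0" using that less.prems by (auto intro: Nat.gr0I)
    show "d < n" using that less.prems dvd_imp_le[of d n] by auto
  qed
  then have "sum ?S ?D = sum mangoldt ?D" by (rule sum.cong[OF refl])
  moreover have "sum ?S {d. d dvd n} = (\<Sum>k<n. ln (norm (1 - unity_root n k)))"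
    using sum_prim_roots[OF less.prems, of "\<lambda>d z. ln (norm (1 - z))"] by simp
  moreover have "\<dots> = ln (real n)"
    using sum.reindex_bij_betw[OF bij_betw_unity_root[OF less.prems], of "\<lambda>z. ln (norm (1 - z))"]
      sum_ln_roots_unity[OF less.prems] by simp
  moreover have "sum mangoldt {d. d dvd n} = ln (real n)"
    using mangoldt_sum[of n, where 'a = real] less.prems by simp
  ultimately show ?case using D by simp
qed

text \<open>Only the prime powers dividing \<open>n\<close> contribute, and each determines its
  \<open>p\<close> and \<open>j\<close>.\<close>

lemma sum_mangoldt_divisors:
  fixes f :: "nat \<Rightarrow> real"
  assumes n: "n > 0"
  shows "(\<Sum>d | d dvd n. f d * mangoldt d) =
    (\<Sum>p\<in>prime_factors n. \<Sum>j\<in>{0<..multiplicity p n}. f (p ^ j) * ln (real p))"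
proof -
  let ?A = "SIGMA p:prime_factors n. {0<..multiplicity p n}"
  have bij: "bij_betw (\<lambda>(p, j). p ^ j) ?A (primepow_factors n)"
    unfolding bij_betw_def
  proof
    show "inj_on (\<lambda>(p, j). p ^ j) ?A"
    proof (rule inj_onI, clarify)
      fix p j q i
      assume *: "p \<in> prime_factors n" "j \<in> {0<..multiplicity p n}"
        "q \<in> prime_factors n" "i \<in> {0<..multiplicity q n}" "p ^ j = q ^ i"
      then have "p = q" using aprimedivisor_prime_power[of p j] aprimedivisor_prime_power[of q i]
        by (auto simp: in_prime_factors_iff)
      moreover from this have "j = i"
        using * prime_gt_1_nat[of q] by (simp add: in_prime_factors_iff power_inject_exp)
      ultimately show "p = q \<and> j = i" by simp
    qed
    show "(\<lambda>(p, j). p ^ j) ` ?A = primepow_factors n"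
      using n by (auto simp: primepow_factors_altdef image_iff) blast
  qed
  have "(\<Sum>d | d dvd n. f d * mangoldt d) = (\<Sum>d\<in>primepow_factors n. f d * mangoldt d)"
    using n by (intro sum.mono_neutral_right) (auto simp: primepow_factors_def mangoldt_def)
  also have "\<dots> = (\<Sum>(p, j)\<in>?A. f (p ^ j) * mangoldt (p ^ j))"
    by (subst sum.reindex_bij_betw[OF bij, symmetric]) (simp add: case_prod_unfold)
  also have "\<dots> = (\<Sum>(p, j)\<in>?A. f (p ^ j) * ln (real p))"
    by (intro sum.cong) (auto simp: in_prime_factors_iff)
  also have "\<dots> = (\<Sum>p\<in>prime_factors n. \<Sum>j\<in>{0<..multiplicity p n}. f (p ^ j) * ln (real p))"
    by (subst sum.Sigma) auto
  finally show ?thesis .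
qed

section \<open>Summation over all pairs of roots of unity\<close>

lemma norm_unity_root_diff:
  assumes "n > 0"
  shows "norm (unity_root n k - unity_root n ((k + c) mod n)) = norm (1 - unity_root n c)"
proof -
  have "unity_root n k - unity_root n ((k + c) mod n) = unity_root n k * (1 - unity_root n c)"
    using assms by (simp add: unity_root_mod unity_root_add algebra_simps)
  then show ?thesis by (simp add: norm_mult)
qed

lemma div_div_dvd_cancel:
  fixes n g :: nat
  assumes "n > 0" "g dvd n"
  shows "n div (n div g) = g"
  using assms by (elim dvdE) auto

lemma div_gcd_eq_iff:
  fixes n :: nat
  assumes "n > 0"
  shows "n div gcd k n = n div gcd l n \<longleftrightarrow> gcd k n = gcd l n"
  using div_div_dvd_cancel[OF assms, of "gcd k n"] div_div_dvd_cancel[OF assms, of "gcd l n"]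
  by (metis gcd_dvd2)

text \<open>Passing to all pairs, at the cost of a factor 2, makes the sum accessible to reindexing
  by exponents.\<close>

lemma double_sum_pairs_less:
  fixes h :: "nat \<Rightarrow> nat \<Rightarrow> real"
  assumes fin: "finite D" and sym: "\<And>d e. h d e = h e d"
  shows "2 * (\<Sum>(d, e)\<in>{(d, e). d \<in> D \<and> e \<in> D \<and> d < e}. h e d) =
    (\<Sum>d\<in>D. \<Sum>e\<in>D. if d \<noteq> e then h d e else 0)"
proof -
  let ?P = "{(d, e). d \<in> D \<and> e \<in> D \<and> d < e}"
  let ?Q = "{(d, e). d \<in> D \<and> e \<in> D \<and> e < d}"
  have finPQ: "finite ?P" "finite ?Q"
    by (rule finite_subset[of _ "D \<times> D"]; use fin in auto)+
  have "(\<Sum>d\<in>D. \<Sum>e\<in>D. if d \<noteq> e then h d e else 0) = (\<Sum>(d, e)\<in>D \<times> D. if d \<noteq> e then h d e else 0)"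
    by (simp add: sum.cartesian_product)
  also have "\<dots> = (\<Sum>(d, e)\<in>?P \<union> ?Q. h d e)"
    using fin by (intro sum.mono_neutral_cong_right) (auto split: if_splits)
  also have "\<dots> = (\<Sum>(d, e)\<in>?P. h d e) + (\<Sum>(d, e)\<in>?Q. h d e)"
    by (rule sum.union_disjoint) (use finPQ in auto)
  also have "(\<Sum>(d, e)\<in>?Q. h d e) = (\<Sum>(d, e)\<in>?P. h e d)"
    by (rule sum.reindex_bij_witness[of _ "\<lambda>(d, e). (e, d)" "\<lambda>(d, e). (e, d)"]) auto
  also have "(\<Sum>(d, e)\<in>?P. h d e) = (\<Sum>(d, e)\<in>?P. h e d)"
    using sym by simp
  finally show ?thesis by simp
qed

text \<open>Replace the roots by their exponents \<open>k\<close> and \<open>l\<close>, substitute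
  \<open>l = k + c\<close> modulo \<open>n\<close>, and sum over \<open>k\<close> first. The
  distance depends on \<open>c\<close> alone, so \<open>gcd_changes\<close> appears as its
  coefficient; grouping the \<open>c\<close> by order then produces \<open>mangoldt\<close>.\<close>

lemma sum_unity_root_pairs:
  assumes n: "n > 0"
  shows "(\<Sum>d | d dvd n. \<Sum>e | e dvd n. if d \<noteq> e then
      \<Sum>x\<in>prim_roots d. \<Sum>y\<in>prim_roots e. ln (norm (x - y)) else 0) =
    (\<Sum>e | e dvd n. real (gcd_changes n (n div e)) * mangoldt e)"
proof -
  let ?D = "{d. d dvd n}" and ?w = "unity_root n"
  have "(\<Sum>d\<in>?D. \<Sum>e\<in>?D. if d \<noteq> e then
      \<Sum>x\<in>prim_roots d. \<Sum>y\<in>prim_roots e. ln (norm (x - y)) else 0) =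
    (\<Sum>d\<in>?D. \<Sum>e\<in>?D. \<Sum>x\<in>prim_roots d. \<Sum>y\<in>prim_roots e. if d \<noteq> e then ln (norm (x - y)) else 0)"
    by (intro sum.cong) auto
  also have "\<dots> = (\<Sum>d\<in>?D. \<Sum>x\<in>prim_roots d. \<Sum>e\<in>?D. \<Sum>y\<in>prim_roots e. if d \<noteq> e then ln (norm (x - y)) else 0)"
    by (intro sum.cong refl sum.swap)
  also have "\<dots> = (\<Sum>k<n. \<Sum>l<n. if gcd k n \<noteq> gcd l n then ln (norm (?w k - ?w l)) else 0)"
    by (simp add: sum_prim_roots[OF n] div_gcd_eq_iff[OF n])
  also have "\<dots> = (\<Sum>k<n. \<Sum>c<n. if gcd k n \<noteq> gcd (k + c) n then ln (norm (1 - ?w c)) else 0)"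
  proof (rule sum.cong[OF refl])
    fix k
    have bij: "bij_betw (\<lambda>c. (k + c) mod n) {..<n} {..<n}"
      using bij_betw_affine_mod[of n 1 k] n by (simp add: add.commute)
    show "(\<Sum>l<n. if gcd k n \<noteq> gcd l n then ln (norm (?w k - ?w l)) else 0) =
        (\<Sum>c<n. if gcd k n \<noteq> gcd (k + c) n then ln (norm (1 - ?w c)) else 0)"
      by (subst sum.reindex_bij_betw[OF bij, symmetric]) (intro sum.cong refl, use n in \<open>auto simp: norm_unity_root_diff\<close>)
  qed
  also have "\<dots> = (\<Sum>c<n. \<Sum>k<n. if gcd k n \<noteq> gcd (k + c) n then ln (norm (1 - ?w c)) else 0)"
    by (rule sum.swap)
  \<comment> \<open>\<open>n div (n div gcd c n)\<close> is \<open>gcd c n\<close>, written so that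
    the coefficient depends on \<open>c\<close> only through the order \<open>n div gcd c n\<close>,
    the form in which \<open>sum_prim_roots\<close> applies.\<close>
  also have "\<dots> = (\<Sum>c<n. real (gcd_changes n (n div (n div gcd c n))) * ln (norm (1 - ?w c)))"
  proof (rule sum.cong[OF refl])
    fix c
    have "(\<Sum>k<n. if gcd k n \<noteq> gcd (k + c) n then ln (norm (1 - ?w c)) else 0) =
        real (gcd_changes n c) * ln (norm (1 - ?w c))"
      by (simp add: gcd_changes_def Int_def flip: sum.inter_filter)
    also have "gcd_changes n c = gcd_changes n (n div (n div gcd c n))"
      using n by (intro gcd_changes_cong) (simp_all add: div_div_dvd_cancel)
    finally show "(\<Sum>k<n. if gcd k n \<noteq> gcd (k + c) n then ln (norm (1 - ?w c)) else 0) =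
        real (gcd_changes n (n div (n div gcd c n))) * ln (norm (1 - ?w c))" .
  qed
  also have "\<dots> = (\<Sum>e\<in>?D. \<Sum>z\<in>prim_roots e. real (gcd_changes n (n div e)) * ln (norm (1 - z)))"
    by (rule sum_prim_roots[OF n, symmetric])
  also have "\<dots> = (\<Sum>e\<in>?D. real (gcd_changes n (n div e)) * mangoldt e)"
    using n by (intro sum.cong refl) (simp add: sum_ln_prim_roots dvd_pos_nat flip: sum_distrib_left)
  finally show ?thesis .
qed

section \<open>The exponent of each prime\<close>

text \<open>Writing \<open>n = p ^ a * m\<close>, the \<open>j\<close>-th term is the count from
  \<open>gcd_changes_prime_power\<close> at \<open>s = a - j\<close>, namely
  \<open>2 * m * p ^ (j - 1)\<close>. The geometric series adds up to \<open>2 * (n - m)\<close>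
  divided by \<open>p - 1\<close>, and this division is exact.\<close>

lemma sum_gcd_changes_prime_powers:
  fixes n p :: nat
  assumes n: "n > 0" and p: "prime p"
  defines "a \<equiv> multiplicity p n"
  shows "(\<Sum>j\<in>{0<..a}. gcd_changes n (n div p ^ j)) = 2 * ((n - n div p ^ a) div (p - 1))"
proof -
  have p1: "p > 1" using p by (rule prime_gt_1_nat)
  define m where "m = n div p ^ a"
  have nm: "n = p ^ a * m" by (simp add: m_def a_def multiplicity_dvd)
  have pm: "\<not> p dvd m"
    unfolding m_def a_def using n p by (intro multiplicity_decompose) auto
  have "(\<Sum>j\<in>{0<..a}. gcd_changes n (n div p ^ j)) = (\<Sum>j\<in>{0<..a}. 2 * (m * p ^ (j - 1)))"
  proof (rule sum.cong[OF refl])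
    fix j assume j: "j \<in> {0<..a}"
    have "p ^ a = p ^ j * p ^ (a - j)" unfolding power_add[symmetric] using j by simp
    then have "n div p ^ j = p ^ (a - j) * m" using p1 by (simp add: nm)
    then have "gcd_changes n (n div p ^ j) = 2 * (m * p ^ (a - Suc (a - j)))"
      using gcd_changes_prime_power[OF p pm, of "a - j" a] j by (simp add: nm)
    also have "a - Suc (a - j) = j - 1" using j by auto
    finally show "gcd_changes n (n div p ^ j) = 2 * (m * p ^ (j - 1))" .
  qed
  also have "\<dots> = 2 * (m * (\<Sum>j\<in>{0<..a}. p ^ (j - 1)))"
    by (simp add: sum_distrib_left)
  also have "(\<Sum>j\<in>{0<..a}. p ^ (j - 1)) = (\<Sum>i<a. p ^ i)"
    by (rule sum.reindex_bij_witness[of _ Suc "\<lambda>j. j - 1"]) auto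
  also have "m * (\<Sum>i<a. p ^ i) = (n - m) div (p - 1)"
  proof -
    have "(p - 1) * (\<Sum>i<a. p ^ i) = p ^ a - 1"
    proof -
      \<comment> \<open>The geometric sum is evaluated over the integers, where subtraction is not
        truncated.\<close>
      have "int ((p - 1) * (\<Sum>i<a. p ^ i)) = (int p - 1) * (\<Sum>i<a. int p ^ i)"
        using p1 by (simp add: of_nat_diff)
      also have "\<dots> = int p ^ a - 1" by (rule power_diff_1_eq[symmetric])
      also have "\<dots> = int (p ^ a - 1)" using p1 by (simp add: of_nat_diff)
      finally show ?thesis by (simp only: of_nat_eq_iff)
    qed
    then have "n - m = (p - 1) * (m * (\<Sum>i<a. p ^ i))"
      by (simp add: nm algebra_simps diff_mult_distrib2)
    then show ?thesis using p1 by simp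
  qed
  finally show ?thesis by (simp add: m_def)
qed

text \<open>Compare twice the logarithms of both sides: the 2 from counting each pair in both orders
  matches the 2 in \<open>sum_gcd_changes_prime_powers\<close>. Both sides are positive, so equal
  logarithms suffice.\<close>

lemma abs_prod_resultant_cyclotomic:
  assumes n: "n > 0"
  defines "P \<equiv> {(d1, d2). d1 dvd n \<and> d2 dvd n \<and> d1 < d2}"
  shows "\<bar>\<Prod>(d1, d2)\<in>P. resultant (cyclotomic d2) (cyclotomic d1)\<bar> =
    (\<Prod>p\<in>prime_factors n. int p ^ ((n - n div p ^ multiplicity p n) div (p - 1)))" (is "?L = ?R")
proof -
  let ?h = "\<lambda>d e. \<Sum>x\<in>prim_roots d. \<Sum>y\<in>prim_roots e. ln (norm (x - y))"
  let ?E = "\<lambda>p. (n - n div p ^ multiplicity p n) div (p - 1)"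
  let ?r = "\<lambda>(d1, d2). resultant (cyclotomic d2) (cyclotomic d1)"
  have finP: "finite P"
    unfolding P_def by (rule finite_subset[of _ "{d. d dvd n} \<times> {d. d dvd n}"]) (use n in auto)
  have pos: "d > 0" if "d dvd n" for d using that n by (rule dvd_pos_nat[rotated])
  have nz: "?r x \<noteq> 0" if "x \<in> P" for x
    using that pos by (auto simp: P_def resultant_cyclotomic_nonzero)
  have sym: "?h d e = ?h e d" for d e
    by (subst sum.swap) (simp add: norm_minus_commute)
  have "ln (real_of_int ?L) = ln (\<Prod>x\<in>P. \<bar>real_of_int (?r x)\<bar>)"
    by (simp add: abs_prod)
  also have "\<dots> = (\<Sum>x\<in>P. ln \<bar>real_of_int (?r x)\<bar>)"
    using finP nz by (intro ln_prod) auto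
  also have "\<dots> = (\<Sum>(d, e)\<in>P. ?h e d)"
    using pos by (intro sum.cong) (auto simp: P_def ln_abs_resultant_cyclotomic)
  finally have "2 * ln (real_of_int ?L) = 2 * (\<Sum>(d, e)\<in>P. ?h e d)" by simp
  also have "\<dots> = (\<Sum>d | d dvd n. \<Sum>e | e dvd n. if d \<noteq> e then ?h d e else 0)"
    using double_sum_pairs_less[of "{d. d dvd n}" ?h] n sym by (simp add: P_def)
  also have "\<dots> = (\<Sum>p\<in>prime_factors n. \<Sum>j\<in>{0<..multiplicity p n}.
      real (gcd_changes n (n div p ^ j)) * ln (real p))"
    by (simp add: sum_unity_root_pairs[OF n] sum_mangoldt_divisors[OF n])
  also have "\<dots> = (\<Sum>p\<in>prime_factors n. 2 * (real (?E p) * ln (real p)))"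
  proof (rule sum.cong[OF refl])
    fix p assume "p \<in> prime_factors n"
    then have "prime p" by (simp add: in_prime_factors_iff)
    from sum_gcd_changes_prime_powers[OF n this]
    have "(\<Sum>j\<in>{0<..multiplicity p n}. real (gcd_changes n (n div p ^ j))) = real (2 * ?E p)"
      by (simp only: of_nat_sum[symmetric])
    then show "(\<Sum>j\<in>{0<..multiplicity p n}. real (gcd_changes n (n div p ^ j)) * ln (real p)) =
        2 * (real (?E p) * ln (real p))"
      by (simp flip: sum_distrib_right)
  qed
  also have "\<dots> = 2 * (\<Sum>p\<in>prime_factors n. ln (real p ^ ?E p))"
    by (simp add: sum_distrib_left ln_realpow in_prime_factors_iff prime_gt_0_nat)
  also have "(\<Sum>p\<in>prime_factors n. ln (real p ^ ?E p)) = ln (\<Prod>p\<in>prime_factors n. real p ^ ?E p)"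
    by (rule ln_prod[symmetric]) (auto simp: in_prime_factors_iff)
  finally have "ln (real_of_int ?L) = ln (real_of_int ?R)" by simp
  moreover have "?L > 0" using nz finP by (simp add: prod_zero_iff)
  moreover have "?R > 0" by (intro prod_pos) (auto simp: in_prime_factors_iff prime_gt_0_nat)
  ultimately have "real_of_int ?L = real_of_int ?R" by (simp only: ln_inj_iff of_int_0_less_iff)
  then show ?thesis by (simp only: of_int_eq_iff)
qed

section \<open>The sign of the product\<close>

text \<open>The pair (1, 2), the only one with a negative resultant, occurs exactly for even
  \<open>n\<close>, which is when \<open>(-1) ^ (n - 1)\<close> is -1.\<close>

lemma sgn_prod_resultant_cyclotomic:
  assumes n: "n > 0"
  defines "P \<equiv> {(d1, d2). d1 dvd n \<and> d2 dvd n \<and> d1 < d2}"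
  shows "(\<Prod>(d1, d2)\<in>P. resultant (cyclotomic d2) (cyclotomic d1)) =
    (-1) ^ (n - 1) * \<bar>\<Prod>(d1, d2)\<in>P. resultant (cyclotomic d2) (cyclotomic d1)\<bar>"
proof -
  let ?r = "\<lambda>(d1, d2). resultant (cyclotomic d2) (cyclotomic d1)"
  have finP: "finite P"
    unfolding P_def by (rule finite_subset[of _ "{d. d dvd n} \<times> {d. d dvd n}"]) (use n in auto)
  have pos: "d > 0" if "d dvd n" for d using that n by (rule dvd_pos_nat[rotated])
  have nonneg: "?r x \<ge> 0" if "x \<in> P - {(1, 2)}" for x
  proof -
    obtain d e where x: "x = (d, e)" "d dvd n" "e dvd n" "d < e"
      using \<open>x \<in> _\<close> by (auto simp: P_def)
    then have "d > 0" using pos by blast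
    \<comment> \<open>The only positive \<open>d < e\<close> with \<open>e \<le> 2\<close> are 1 and
      2, the pair that was removed.\<close>
    moreover have "e > 2" using x \<open>x \<in> _\<close> \<open>d > 0\<close> by (cases "e = 2") auto
    ultimately show ?thesis using x by (auto intro: resultant_cyclotomic_nonneg)
  qed
  have rest: "prod ?r (P - {(1, 2)}) \<ge> 0" using nonneg by (intro prod_nonneg) blast
  show ?thesis
  proof (cases "even n")
    case True
    then have "(1, 2) \<in> P" by (simp add: P_def)
    then have "prod ?r P = - 2 * prod ?r (P - {(1, 2)})"
      using finP by (simp add: prod.remove resultant_cyclotomic_2_1[unfolded One_nat_def])
    moreover have "(-1 :: int) ^ (n - 1) = -1" using True n by simp
    ultimately show ?thesis using rest by (simp add: abs_mult)
  next
    case False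
    then have "P - {(1, 2)} = P" by (auto simp: P_def)
    then show ?thesis using rest False by simp
  qed
qed

theorem theoremA2:
  fixes n :: nat
  assumes "n > 0"
  shows "det (A_mat n) =
           (\<Prod>(d1, d2)\<in>{(d1, d2). d1 dvd n \<and> d2 dvd n \<and> 1 \<le> d1 \<and> d1 < d2 \<and> d2 \<le> n}.
              resultant (cyclotomic d2) (cyclotomic d1))
       \<and> (\<Prod>(d1, d2)\<in>{(d1, d2). d1 dvd n \<and> d2 dvd n \<and> 1 \<le> d1 \<and> d1 < d2 \<and> d2 \<le> n}.
              resultant (cyclotomic d2) (cyclotomic d1))
         = (-1) ^ (n - 1) *
           (\<Prod>p\<in>prime_factors n.
              int p ^ ((n - n div p ^ multiplicity p n) div (p - 1)))"
proof -
  have pairs: "{(d1, d2). d1 dvd n \<and> d2 dvd n \<and> 1 \<le> d1 \<and> d1 < d2 \<and> d2 \<le> n} =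
      {(d1, d2). d1 dvd n \<and> d2 dvd n \<and> d1 < d2}"
    using assms dvd_imp_le[of _ n] dvd_pos_nat[of n] by (auto simp: Suc_le_eq)
  show ?thesis
    unfolding pairs det_A_mat[OF assms]
    using sgn_prod_resultant_cyclotomic[OF assms]
    unfolding abs_prod_resultant_cyclotomic[OF assms] by simp
qed

end
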